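(* Let $\mathcal G$ be a 2-graph and let $\mathcal S(\mathcal G)$ be the syntactic bicategory, with a single fixed variable name $x$, of the type theory $\Lambda^{\mathrm b}(\mathcal G)$ (defined in the context). Let $\iota:\mathcal G\hookrightarrow\mathcal S(\mathcal G)$ be the inclusion. For any bicategory $\mathcal B$ and any 2-graph homomorphism $h:\mathcal G\to\mathcal B$ there exists a unique strict pseudofunctor $h^{\#}:\mathcal S(\mathcal G)\to\mathcal B$ such that $h^{\#}\circ\iota=h$.
   Context: **2-graphs.** A 2-graph $\mathcal G$ is a set $\mathcal G_0$ of nodes together with, for all $A,B\in\mathcal G_0$, a directed graph $\mathcal G(A;B)$, whose nodes are called edges and whose arrows are called surfaces; $\mathcal G(A;B)(c,c')$ is the set of surfaces from $c$ to $c'$. A homomorphism maps nodes, edges and surfaces compatibly. Every bicategory has an underlying 2-graph (objects, 1-cells, 2-cells), and a homomorphism $\mathcal G\to\mathcal B$ means one into this underlying 2-graph. **Pseudofunctors.** A pseudofunctor is strict if its structural 2-cells $\mathrm{Id}_{FX}\Rightarrow F(\mathrm{Id}_X)$ and $F(f)\circ F(g)\Rightarrow F(f\circ g)$ are identities. Vertical composition is written $\bullet$. **The type theory $\Lambda^{\mathrm b}(\mathcal G)$.** Types are the nodes of $\mathcal G$. Contexts are unary, $(x:A)$. Judgements are $x:A\vdash t:B$ (terms), $x:A\vdash\tau:t\Rightarrow t':B$ (rewrites), and $x:A\vdash\tau\equiv\tau':t\Rightarrow t':B$. Terms and rewrites are taken up to $\alpha$-equivalence. *Terms:* - $x:A\vdash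 x:A$; - $x:A\vdash c(x):B$ for each edge $c\in\mathcal G(A;B)$; - if $x:A\vdash t:B$ and $y:D\vdash u:A$ then $y:D\vdash t\{x\mapsto u\}:B$ (explicit substitution, binding $x$ in $t$). *Rewrites:* - $\mathrm{id}_t:t\Rightarrow t$; - $x:A\vdash\sigma(x):c(x)\Rightarrow c'(x):B$ for each surface $\sigma\in\mathcal G(A;B)(c,c')$; - $\iota_t:t\Rightarrow t\{x\mapsto x\}$; - $\varrho_u:x\{x\mapsto u\}\Rightarrow u$; - $\mathsf{assoc}_{t,v,u}:t\{y\mapsto v\}\{x\mapsto u\}\Rightarrow t\{y\mapsto v\{x\mapsto u\}\}$; - formal inverses of $\iota,\varrho,\mathsf{assoc}$; - $\tau'\bullet\tau:t\Rightarrow t''$ for $\tau:t\Rightarrow t'$, $\tau':t'\Rightarrow t''$; - $\tau\{x\mapsto\sigma\}:t\{x\mapsto u\}\Rightarrow t'\{x\mapsto u'\}$ for $\tau:t\Rightarrow t'$, $\sigma:u\Rightarrow u'$. *Equations:* $\equiv$ is the least congruence (equivalence relation compatible with all rewrite constructors) on rewrites such that (writing $t$ for $\mathrm{id}_t$ inside rewrites): - $\bullet$ is associative with units $\mathrm{id}$; - $\mathrm{id}_t\{x\mapsto \mathrm{id}_u\}\equiv\mathrm{id}_{t\{x\mapsto u\}}$; - $\tau'\{x\mapsto\sigma'\}\bullet\tau\{x\mapsto\sigma\}\equiv(\tau'\bullet\tau)\{x\mapsto\sigma'\bullet\sigma\}$; - naturality: $\varrho_{u'}\bullet x\{x\mapsto\sigma\}\equiv\sigma\bullet\varrho_u$,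 $\ \iota_{t'}\bullet\tau\equiv\tau\{x\mapsto x\}\bullet\iota_t$, $\ \mathsf{assoc}_{t',v',u'}\bullet\tau\{y\mapsto\sigma\}\{x\mapsto\mu\}\equiv\tau\{y\mapsto\sigma\{x\mapsto\mu\}\}\bullet\mathsf{assoc}_{t,v,u}$; - $t\{x\mapsto\varrho_u\}\bullet\mathsf{assoc}_{t,x,u}\bullet\iota_t\{x\mapsto u\}\equiv\mathrm{id}_{t\{x\mapsto u\}}$; - $t\{z\mapsto\mathsf{assoc}_{w,v,u}\}\bullet\mathsf{assoc}_{t,w\{y\mapsto v\},u}\bullet\mathsf{assoc}_{t,w,v}\{x\mapsto u\}\equiv\mathsf{assoc}_{t,w,v\{x\mapsto u\}}\bullet\mathsf{assoc}_{t\{z\mapsto w\},v,u}$; - the formal inverses are two-sided inverses. **The bicategory $\mathcal S(\mathcal G)$.** Fix a variable $x$. Objects are the unary contexts $(x:A)$, $A\in\mathcal G_0$. The hom-category from $(x:A)$ to $(x:B)$ has as objects $\alpha$-equivalence classes of derivable terms $x:A\vdash t:B$ and as morphisms equivalence classes, modulo $\alpha$-equivalence and $\equiv$, of derivable rewrites $x:A\vdash\tau:t\Rightarrow t':B$, composed by $\bullet$. Horizontal composition is explicit substitution, $t\circ u=t\{x\mapsto u\}$ and $\tau\circ\sigma=\tau\{x\mapsto\sigma\}$; the identity on $(x:A)$ is the term $x$. The structural isomorphisms are $\mathbf l=\varrho:\mathrm{Id}\circ u\Rightarrow u$, $\mathbf r=\iota^{-1}:t\circ\mathrm{Id}\Rightarrow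 t$, $\mathbf a=\mathsf{assoc}$. The inclusion $\iota:\mathcal G\hookrightarrow\mathcal S(\mathcal G)$ sends $A\mapsto(x:A)$, $c\mapsto c(x)$, $\sigma\mapsto\sigma(x)$. *)

theory Defs
  imports "HOL-Combinatorics.Transposition"
begin

section \<open>2-graphs\<close>

text \<open>
  The types carry no disjointness requirement: the same element may be an edge (a surface) between
  several pairs of nodes (edges). Hence everything below is indexed by endpoints. \<^term>\<open>Edge G A B\<close>
  matters only for nodes \<^term>\<open>A\<close>, \<^term>\<open>B\<close>, and \<^term>\<open>Surf G A B c c'\<close> only for edges
  \<^term>\<open>c\<close>, \<^term>\<open>c'\<close> between nodes \<^term>\<open>A\<close>, \<^term>\<open>B\<close>.
\<close>

record ('n, 'e, 's) two_graph =
  Node :: "'n set"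
  Edge :: "'n \<Rightarrow> 'n \<Rightarrow> 'e set"
  Surf :: "'n \<Rightarrow> 'n \<Rightarrow> 'e \<Rightarrow> 'e \<Rightarrow> 's set"

record ('n, 'e, 's, 'o, 'a, 'c) hom =
  on_node :: "'n \<Rightarrow> 'o"
  on_edge :: "'n \<Rightarrow> 'n \<Rightarrow> 'e \<Rightarrow> 'a"
  on_surf :: "'n \<Rightarrow> 'n \<Rightarrow> 'e \<Rightarrow> 'e \<Rightarrow> 's \<Rightarrow> 'c"

definition two_graph_hom ::
  "('n, 'e, 's, 'x) two_graph_scheme \<Rightarrow> ('o, 'a, 'c, 'y) two_graph_scheme \<Rightarrow>
   ('n, 'e, 's, 'o, 'a, 'c, 'z) hom_scheme \<Rightarrow> bool" where
  "two_graph_hom G H h \<longleftrightarrow>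
    (\<forall>A\<in>Node G. on_node h A \<in> Node H) \<and>
    (\<forall>A\<in>Node G. \<forall>B\<in>Node G. \<forall>c\<in>Edge G A B.
       on_edge h A B c \<in> Edge H (on_node h A) (on_node h B)) \<and>
    (\<forall>A\<in>Node G. \<forall>B\<in>Node G. \<forall>c\<in>Edge G A B. \<forall>c'\<in>Edge G A B. \<forall>\<sigma>\<in>Surf G A B c c'.
       on_surf h A B c c' \<sigma> \<in>
         Surf H (on_node h A) (on_node h B) (on_edge h A B c) (on_edge h A B c'))"

text \<open>
  HOL functions are total, so equality of homomorphisms out of \<^term>\<open>G\<close> means
  agreement on the nodes, edges and surfaces of \<^term>\<open>G\<close>.
\<close>

definition hom_eq ::
  "('n, 'e, 's, 'x) two_graph_scheme \<Rightarrow> ('n, 'e, 's, 'o, 'a, 'c, 'y) hom_scheme \<Rightarrow>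
   ('n, 'e, 's, 'o, 'a, 'c, 'z) hom_scheme \<Rightarrow> bool" where
  "hom_eq G h k \<longleftrightarrow>
    (\<forall>A\<in>Node G. on_node h A = on_node k A) \<and>
    (\<forall>A\<in>Node G. \<forall>B\<in>Node G. \<forall>c\<in>Edge G A B. on_edge h A B c = on_edge k A B c) \<and>
    (\<forall>A\<in>Node G. \<forall>B\<in>Node G. \<forall>c\<in>Edge G A B. \<forall>c'\<in>Edge G A B. \<forall>\<sigma>\<in>Surf G A B c c'.
       on_surf h A B c c' \<sigma> = on_surf k A B c c' \<sigma>)"

definition hom_comp ::
  "('n, 'e, 's, 'o, 'a, 'c, 'x) hom_scheme \<Rightarrow> ('m, 'd, 'r, 'n, 'e, 's, 'y) hom_scheme \<Rightarrow>
   ('m, 'd, 'r, 'o, 'a, 'c) hom" where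
  "hom_comp k h =
    \<lparr>on_node = \<lambda>A. on_node k (on_node h A),
     on_edge = \<lambda>A B c. on_edge k (on_node h A) (on_node h B) (on_edge h A B c),
     on_surf = \<lambda>A B c c' \<sigma>. on_surf k (on_node h A) (on_node h B)
       (on_edge h A B c) (on_edge h A B c') (on_surf h A B c c' \<sigma>)\<rparr>"


section \<open>Bicategories\<close>

text \<open>
  A bicategory extends its underlying 2-graph: objects, 1-cells and 2-cells are the nodes, edges and
  surfaces. All compositions are in applicative order: for \<open>f : X \<rightarrow> Y\<close> and \<open>g : Y \<rightarrow> Z\<close>,
  \<open>Comp1 B X Y Z g f\<close> is \<open>g \<circ> f\<close>, and for 2-cells
  \<open>HComp B X Y Z \<beta> \<alpha>\<close> is \<open>\<beta> \<circ> \<alpha>\<close>; \<open>VComp B X Y \<beta> \<alpha>\<close> is the composite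
  \<open>\<beta> \<bullet> \<alpha>\<close> in the category of 1-cells \<open>X \<rightarrow> Y\<close>.
  The operations on 2-cells are indexed by objects only, as usual for categories whose arrows
  determine their domain and codomain.
\<close>

record ('o, 'a, 'c) bicat = "('o, 'a, 'c) two_graph" +
  Id1 :: "'o \<Rightarrow> 'a"
  Comp1 :: "'o \<Rightarrow> 'o \<Rightarrow> 'o \<Rightarrow> 'a \<Rightarrow> 'a \<Rightarrow> 'a"
  Id2 :: "'o \<Rightarrow> 'o \<Rightarrow> 'a \<Rightarrow> 'c"
  VComp :: "'o \<Rightarrow> 'o \<Rightarrow> 'c \<Rightarrow> 'c \<Rightarrow> 'c"
  HComp :: "'o \<Rightarrow> 'o \<Rightarrow> 'o \<Rightarrow> 'c \<Rightarrow> 'c \<Rightarrow> 'c"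
  LUnit :: "'o \<Rightarrow> 'o \<Rightarrow> 'a \<Rightarrow> 'c"
  RUnit :: "'o \<Rightarrow> 'o \<Rightarrow> 'a \<Rightarrow> 'c"
  Asc :: "'o \<Rightarrow> 'o \<Rightarrow> 'o \<Rightarrow> 'o \<Rightarrow> 'a \<Rightarrow> 'a \<Rightarrow> 'a \<Rightarrow> 'c"

definition iso_cell ::
  "('o, 'a, 'c, 'x) bicat_scheme \<Rightarrow> 'o \<Rightarrow> 'o \<Rightarrow> 'a \<Rightarrow> 'a \<Rightarrow> 'c \<Rightarrow> bool" where
  "iso_cell B X Y f g \<alpha> \<longleftrightarrow> \<alpha> \<in> Surf B X Y f g \<and>
    (\<exists>\<beta>\<in>Surf B X Y g f. VComp B X Y \<beta> \<alpha> = Id2 B X Y f \<and> VComp B X Y \<alpha> \<beta> = Id2 B X Y g)"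

locale bicategory =
  fixes B :: "('o, 'a, 'c, 'x) bicat_scheme"
  \<comment> \<open>hom-categories\<close>
  assumes Id2_cell:
    "\<lbrakk>X \<in> Node B; Y \<in> Node B; f \<in> Edge B X Y\<rbrakk> \<Longrightarrow> Id2 B X Y f \<in> Surf B X Y f f"
  and VComp_cell:
    "\<lbrakk>X \<in> Node B; Y \<in> Node B; f \<in> Edge B X Y; g \<in> Edge B X Y; h \<in> Edge B X Y;
      \<alpha> \<in> Surf B X Y f g; \<beta> \<in> Surf B X Y g h\<rbrakk> \<Longrightarrow> VComp B X Y \<beta> \<alpha> \<in> Surf B X Y f h"
  and VComp_assoc:
    "\<lbrakk>X \<in> Node B; Y \<in> Node B;
      f \<in> Edge B X Y; g \<in> Edge B X Y; h \<in> Edge B X Y; k \<in> Edge B X Y;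
      \<alpha> \<in> Surf B X Y f g; \<beta> \<in> Surf B X Y g h; \<gamma> \<in> Surf B X Y h k\<rbrakk> \<Longrightarrow>
     VComp B X Y (VComp B X Y \<gamma> \<beta>) \<alpha> = VComp B X Y \<gamma> (VComp B X Y \<beta> \<alpha>)"
  and VComp_Id2_left:
    "\<lbrakk>X \<in> Node B; Y \<in> Node B; f \<in> Edge B X Y; g \<in> Edge B X Y; \<alpha> \<in> Surf B X Y f g\<rbrakk> \<Longrightarrow>
     VComp B X Y (Id2 B X Y g) \<alpha> = \<alpha>"
  and VComp_Id2_right:
    "\<lbrakk>X \<in> Node B; Y \<in> Node B; f \<in> Edge B X Y; g \<in> Edge B X Y; \<alpha> \<in> Surf B X Y f g\<rbrakk> \<Longrightarrow>
     VComp B X Y \<alpha> (Id2 B X Y f) = \<alpha>"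
  \<comment> \<open>identities and the horizontal composition functors\<close>
  and Id1_edge:
    "X \<in> Node B \<Longrightarrow> Id1 B X \<in> Edge B X X"
  and Comp1_edge:
    "\<lbrakk>X \<in> Node B; Y \<in> Node B; Z \<in> Node B; f \<in> Edge B X Y; g \<in> Edge B Y Z\<rbrakk> \<Longrightarrow>
     Comp1 B X Y Z g f \<in> Edge B X Z"
  and HComp_cell:
    "\<lbrakk>X \<in> Node B; Y \<in> Node B; Z \<in> Node B;
      f \<in> Edge B X Y; f' \<in> Edge B X Y; g \<in> Edge B Y Z; g' \<in> Edge B Y Z;
      \<alpha> \<in> Surf B X Y f f'; \<beta> \<in> Surf B Y Z g g'\<rbrakk> \<Longrightarrow>
     HComp B X Y Z \<beta> \<alpha> \<in> Surf B X Z (Comp1 B X Y Z g f) (Comp1 B X Y Z g' f')"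
  and HComp_Id2:
    "\<lbrakk>X \<in> Node B; Y \<in> Node B; Z \<in> Node B; f \<in> Edge B X Y; g \<in> Edge B Y Z\<rbrakk> \<Longrightarrow>
     HComp B X Y Z (Id2 B Y Z g) (Id2 B X Y f) = Id2 B X Z (Comp1 B X Y Z g f)"
  and interchange:
    "\<lbrakk>X \<in> Node B; Y \<in> Node B; Z \<in> Node B;
      f \<in> Edge B X Y; f' \<in> Edge B X Y; f'' \<in> Edge B X Y;
      g \<in> Edge B Y Z; g' \<in> Edge B Y Z; g'' \<in> Edge B Y Z;
      \<alpha> \<in> Surf B X Y f f'; \<alpha>' \<in> Surf B X Y f' f'';
      \<beta> \<in> Surf B Y Z g g'; \<beta>' \<in> Surf B Y Z g' g''\<rbrakk> \<Longrightarrow>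
     HComp B X Y Z (VComp B Y Z \<beta>' \<beta>) (VComp B X Y \<alpha>' \<alpha>) =
     VComp B X Z (HComp B X Y Z \<beta>' \<alpha>') (HComp B X Y Z \<beta> \<alpha>)"
  \<comment> \<open>structural isomorphisms\<close>
  and LUnit_iso:
    "\<lbrakk>X \<in> Node B; Y \<in> Node B; f \<in> Edge B X Y\<rbrakk> \<Longrightarrow>
     iso_cell B X Y (Comp1 B X Y Y (Id1 B Y) f) f (LUnit B X Y f)"
  and RUnit_iso:
    "\<lbrakk>X \<in> Node B; Y \<in> Node B; f \<in> Edge B X Y\<rbrakk> \<Longrightarrow>
     iso_cell B X Y (Comp1 B X X Y f (Id1 B X)) f (RUnit B X Y f)"
  and Asc_iso:
    "\<lbrakk>W \<in> Node B; X \<in> Node B; Y \<in> Node B; Z \<in> Node B;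
      f \<in> Edge B W X; g \<in> Edge B X Y; h \<in> Edge B Y Z\<rbrakk> \<Longrightarrow>
     iso_cell B W Z
       (Comp1 B W X Z (Comp1 B X Y Z h g) f) (Comp1 B W Y Z h (Comp1 B W X Y g f))
       (Asc B W X Y Z h g f)"
  and LUnit_natural:
    "\<lbrakk>X \<in> Node B; Y \<in> Node B; f \<in> Edge B X Y; f' \<in> Edge B X Y; \<alpha> \<in> Surf B X Y f f'\<rbrakk> \<Longrightarrow>
     VComp B X Y (LUnit B X Y f') (HComp B X Y Y (Id2 B Y Y (Id1 B Y)) \<alpha>) =
     VComp B X Y \<alpha> (LUnit B X Y f)"
  and RUnit_natural:
    "\<lbrakk>X \<in> Node B; Y \<in> Node B; f \<in> Edge B X Y; f' \<in> Edge B X Y; \<alpha> \<in> Surf B X Y f f'\<rbrakk> \<Longrightarrow>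
     VComp B X Y (RUnit B X Y f') (HComp B X X Y \<alpha> (Id2 B X X (Id1 B X))) =
     VComp B X Y \<alpha> (RUnit B X Y f)"
  and Asc_natural:
    "\<lbrakk>W \<in> Node B; X \<in> Node B; Y \<in> Node B; Z \<in> Node B;
      f \<in> Edge B W X; f' \<in> Edge B W X; g \<in> Edge B X Y; g' \<in> Edge B X Y;
      h \<in> Edge B Y Z; h' \<in> Edge B Y Z;
      \<alpha> \<in> Surf B W X f f'; \<beta> \<in> Surf B X Y g g'; \<gamma> \<in> Surf B Y Z h h'\<rbrakk> \<Longrightarrow>
     VComp B W Z (Asc B W X Y Z h' g' f') (HComp B W X Z (HComp B X Y Z \<gamma> \<beta>) \<alpha>) =
     VComp B W Z (HComp B W Y Z \<gamma> (HComp B W X Y \<beta> \<alpha>)) (Asc B W X Y Z h g f)"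
  and triangle:
    "\<lbrakk>X \<in> Node B; Y \<in> Node B; Z \<in> Node B; f \<in> Edge B X Y; g \<in> Edge B Y Z\<rbrakk> \<Longrightarrow>
     VComp B X Z (HComp B X Y Z (Id2 B Y Z g) (LUnit B X Y f)) (Asc B X Y Y Z g (Id1 B Y) f) =
     HComp B X Y Z (RUnit B Y Z g) (Id2 B X Y f)"
  and pentagon:
    "\<lbrakk>V \<in> Node B; W \<in> Node B; X \<in> Node B; Y \<in> Node B; Z \<in> Node B;
      f \<in> Edge B V W; g \<in> Edge B W X; h \<in> Edge B X Y; k \<in> Edge B Y Z\<rbrakk> \<Longrightarrow>
     VComp B V Z (HComp B V Y Z (Id2 B Y Z k) (Asc B V W X Y h g f))
       (VComp B V Z (Asc B V W Y Z k (Comp1 B W X Y h g) f)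
         (HComp B V W Z (Asc B W X Y Z k h g) (Id2 B V W f))) =
     VComp B V Z (Asc B V X Y Z k h (Comp1 B V W X g f))
       (Asc B V W X Z (Comp1 B X Y Z k h) g f)"


section \<open>Pseudofunctors\<close>

text \<open>
  A pseudofunctor is a homomorphism of underlying 2-graphs together with structural 2-cells
  \<open>unit_cell F X : Id \<Rightarrow> F(Id)\<close> and \<open>comp_cell F X Y Z g f : F(g) \<circ> F(f) \<Rightarrow> F(g \<circ> f)\<close>.
\<close>

record ('n, 'e, 's, 'o, 'a, 'c) psfun = "('n, 'e, 's, 'o, 'a, 'c) hom" +
  unit_cell :: "'n \<Rightarrow> 'c"
  comp_cell :: "'n \<Rightarrow> 'n \<Rightarrow> 'n \<Rightarrow> 'e \<Rightarrow> 'e \<Rightarrow> 'c"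

locale pseudofunctor = C: bicategory C + D: bicategory D
  for C :: "('n, 'e, 's, 'x) bicat_scheme" and D :: "('o, 'a, 'c, 'y) bicat_scheme" +
  fixes F :: "('n, 'e, 's, 'o, 'a, 'c) psfun"
  assumes hom: "two_graph_hom C D F"
  and map_Id2:
    "\<lbrakk>X \<in> Node C; Y \<in> Node C; f \<in> Edge C X Y\<rbrakk> \<Longrightarrow>
     on_surf F X Y f f (Id2 C X Y f) = Id2 D (on_node F X) (on_node F Y) (on_edge F X Y f)"
  and map_VComp:
    "\<lbrakk>X \<in> Node C; Y \<in> Node C; f \<in> Edge C X Y; g \<in> Edge C X Y; h \<in> Edge C X Y;
      \<alpha> \<in> Surf C X Y f g; \<beta> \<in> Surf C X Y g h\<rbrakk> \<Longrightarrow>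
     on_surf F X Y f h (VComp C X Y \<beta> \<alpha>) =
     VComp D (on_node F X) (on_node F Y) (on_surf F X Y g h \<beta>) (on_surf F X Y f g \<alpha>)"
  and unit_cell_iso:
    "X \<in> Node C \<Longrightarrow>
     iso_cell D (on_node F X) (on_node F X)
       (Id1 D (on_node F X)) (on_edge F X X (Id1 C X)) (unit_cell F X)"
  and comp_cell_iso:
    "\<lbrakk>X \<in> Node C; Y \<in> Node C; Z \<in> Node C; f \<in> Edge C X Y; g \<in> Edge C Y Z\<rbrakk> \<Longrightarrow>
     iso_cell D (on_node F X) (on_node F Z)
       (Comp1 D (on_node F X) (on_node F Y) (on_node F Z) (on_edge F Y Z g) (on_edge F X Y f))
       (on_edge F X Z (Comp1 C X Y Z g f)) (comp_cell F X Y Z g f)"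
  and comp_cell_natural:
    "\<lbrakk>X \<in> Node C; Y \<in> Node C; Z \<in> Node C;
      f \<in> Edge C X Y; f' \<in> Edge C X Y; g \<in> Edge C Y Z; g' \<in> Edge C Y Z;
      \<alpha> \<in> Surf C X Y f f'; \<beta> \<in> Surf C Y Z g g'\<rbrakk> \<Longrightarrow>
     VComp D (on_node F X) (on_node F Z)
       (on_surf F X Z (Comp1 C X Y Z g f) (Comp1 C X Y Z g' f') (HComp C X Y Z \<beta> \<alpha>))
       (comp_cell F X Y Z g f) =
     VComp D (on_node F X) (on_node F Z)
       (comp_cell F X Y Z g' f')
       (HComp D (on_node F X) (on_node F Y) (on_node F Z)
         (on_surf F Y Z g g' \<beta>) (on_surf F X Y f f' \<alpha>))"
  and left_unit_coherence:
    "\<lbrakk>X \<in> Node C; Y \<in> Node C; f \<in> Edge C X Y\<rbrakk> \<Longrightarrow>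
     VComp D (on_node F X) (on_node F Y)
       (on_surf F X Y (Comp1 C X Y Y (Id1 C Y) f) f (LUnit C X Y f))
       (VComp D (on_node F X) (on_node F Y)
         (comp_cell F X Y Y (Id1 C Y) f)
         (HComp D (on_node F X) (on_node F Y) (on_node F Y)
           (unit_cell F Y) (Id2 D (on_node F X) (on_node F Y) (on_edge F X Y f)))) =
     LUnit D (on_node F X) (on_node F Y) (on_edge F X Y f)"
  and right_unit_coherence:
    "\<lbrakk>X \<in> Node C; Y \<in> Node C; f \<in> Edge C X Y\<rbrakk> \<Longrightarrow>
     VComp D (on_node F X) (on_node F Y)
       (on_surf F X Y (Comp1 C X X Y f (Id1 C X)) f (RUnit C X Y f))
       (VComp D (on_node F X) (on_node F Y)
         (comp_cell F X X Y f (Id1 C X))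
         (HComp D (on_node F X) (on_node F X) (on_node F Y)
           (Id2 D (on_node F X) (on_node F Y) (on_edge F X Y f)) (unit_cell F X))) =
     RUnit D (on_node F X) (on_node F Y) (on_edge F X Y f)"
  and assoc_coherence:
    "\<lbrakk>W \<in> Node C; X \<in> Node C; Y \<in> Node C; Z \<in> Node C;
      f \<in> Edge C W X; g \<in> Edge C X Y; h \<in> Edge C Y Z\<rbrakk> \<Longrightarrow>
     VComp D (on_node F W) (on_node F Z)
       (on_surf F W Z
         (Comp1 C W X Z (Comp1 C X Y Z h g) f) (Comp1 C W Y Z h (Comp1 C W X Y g f))
         (Asc C W X Y Z h g f))
       (VComp D (on_node F W) (on_node F Z)
         (comp_cell F W X Z (Comp1 C X Y Z h g) f)
         (HComp D (on_node F W) (on_node F X) (on_node F Z)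
           (comp_cell F X Y Z h g) (Id2 D (on_node F W) (on_node F X) (on_edge F W X f)))) =
     VComp D (on_node F W) (on_node F Z)
       (comp_cell F W Y Z h (Comp1 C W X Y g f))
       (VComp D (on_node F W) (on_node F Z)
         (HComp D (on_node F W) (on_node F Y) (on_node F Z)
           (Id2 D (on_node F Y) (on_node F Z) (on_edge F Y Z h)) (comp_cell F W X Y g f))
         (Asc D (on_node F W) (on_node F X) (on_node F Y) (on_node F Z)
           (on_edge F Y Z h) (on_edge F X Y g) (on_edge F W X f)))"

text \<open>A structural 2-cell is an identity only if its source and target coincide.\<close>

locale strict_pseudofunctor = pseudofunctor C D F
  for C :: "('n, 'e, 's, 'x) bicat_scheme" and D :: "('o, 'a, 'c, 'y) bicat_scheme"
    and F :: "('n, 'e, 's, 'o, 'a, 'c) psfun" +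
  assumes strict_Id1:
    "X \<in> Node C \<Longrightarrow> on_edge F X X (Id1 C X) = Id1 D (on_node F X)"
  and strict_unit_cell:
    "X \<in> Node C \<Longrightarrow>
     unit_cell F X = Id2 D (on_node F X) (on_node F X) (Id1 D (on_node F X))"
  and strict_Comp1:
    "\<lbrakk>X \<in> Node C; Y \<in> Node C; Z \<in> Node C; f \<in> Edge C X Y; g \<in> Edge C Y Z\<rbrakk> \<Longrightarrow>
     on_edge F X Z (Comp1 C X Y Z g f) =
     Comp1 D (on_node F X) (on_node F Y) (on_node F Z) (on_edge F Y Z g) (on_edge F X Y f)"
  and strict_comp_cell:
    "\<lbrakk>X \<in> Node C; Y \<in> Node C; Z \<in> Node C; f \<in> Edge C X Y; g \<in> Edge C Y Z\<rbrakk> \<Longrightarrow>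
     comp_cell F X Y Z g f = Id2 D (on_node F X) (on_node F Z)
       (Comp1 D (on_node F X) (on_node F Y) (on_node F Z) (on_edge F Y Z g) (on_edge F X Y f))"

definition psfun_eq ::
  "('n, 'e, 's, 'x) bicat_scheme \<Rightarrow> ('n, 'e, 's, 'o, 'a, 'c) psfun \<Rightarrow>
   ('n, 'e, 's, 'o, 'a, 'c) psfun \<Rightarrow> bool" where
  "psfun_eq C F F' \<longleftrightarrow> hom_eq C F F' \<and>
    (\<forall>X\<in>Node C. unit_cell F X = unit_cell F' X) \<and>
    (\<forall>X\<in>Node C. \<forall>Y\<in>Node C. \<forall>Z\<in>Node C. \<forall>f\<in>Edge C X Y. \<forall>g\<in>Edge C Y Z.
       comp_cell F X Y Z g f = comp_cell F' X Y Z g f)"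


section \<open>Terms and rewrites up to alpha-equivalence\<close>

type_synonym var = nat

text \<open>
  Constants carry their endpoints, since the sets of edges (surfaces) of a 2-graph may overlap.
  In \<^term>\<open>rSub t x u\<close>, that is \<open>t{x \<mapsto> u}\<close>, the variable \<open>x\<close> is bound in \<open>t\<close>.
  The generated maps \<open>rename_trm\<close> and \<open>rename_rw\<close> rename all variables, bound ones included; they
  are used for transpositions only, as in nominal syntax.
\<close>

datatype (dead 'n, dead 'e, 'v) raw_trm =
    rVar 'v
  | rCst 'n 'n 'e 'v
  | rSub "('n, 'e, 'v) raw_trm" 'v "('n, 'e, 'v) raw_trm"
  for map: rename_trm

primrec fv_trm :: "('n, 'e, 'v) raw_trm \<Rightarrow> 'v set" where
  "fv_trm (rVar x) = {x}"
| "fv_trm (rCst A B c x) = {x}"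
| "fv_trm (rSub t x u) = (fv_trm t - {x}) \<union> fv_trm u"

inductive alpha_trm :: "('n, 'e, var) raw_trm \<Rightarrow> ('n, 'e, var) raw_trm \<Rightarrow> bool" where
  refl: "alpha_trm t t"
| sym: "alpha_trm t t' \<Longrightarrow> alpha_trm t' t"
| trans: "\<lbrakk>alpha_trm t t'; alpha_trm t' t''\<rbrakk> \<Longrightarrow> alpha_trm t t''"
| Sub: "\<lbrakk>alpha_trm t t'; alpha_trm u u'\<rbrakk> \<Longrightarrow> alpha_trm (rSub t x u) (rSub t' x u')"
| rebind: "z \<notin> fv_trm t \<Longrightarrow>
    alpha_trm (rSub t x u) (rSub (rename_trm (transpose x z) t) z u)"

text \<open>
  In \<open>assoc\<^bsub>t,v,u\<^esub> : t{y \<mapsto> v}{x \<mapsto> u} \<Rightarrow> t{y \<mapsto> v{x \<mapsto> u}}\<close>, written \<open>rAssoc t y v x u\<close>,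
  the variable \<open>y\<close> is bound in \<open>t\<close> and \<open>x\<close> is bound in \<open>v\<close>. In \<open>rRSub \<tau> x \<sigma>\<close>, that is
  \<open>\<tau>{x \<mapsto> \<sigma>}\<close>, the variable \<open>x\<close> is bound in \<open>\<tau>\<close>. The other constructors bind nothing: the
  variable of \<open>\<iota>\<^bsub>t\<^esub> : t \<Rightarrow> t{x \<mapsto> x}\<close> is the free one of \<open>t\<close>, given by the context, and the source
  \<open>x{x \<mapsto> u}\<close> of \<open>\<rho>\<^bsub>u\<^esub>\<close> does not depend on \<open>x\<close> up to alpha-equivalence.
\<close>

datatype (dead 'n, dead 'e, dead 's, 'v) raw_rw =
    rIdent "('n, 'e, 'v) raw_trm"
  | rSurface 'n 'n 'e 'e 's 'v
  | rIota "('n, 'e, 'v) raw_trm"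
  | rRho "('n, 'e, 'v) raw_trm"
  | rAssoc "('n, 'e, 'v) raw_trm" 'v "('n, 'e, 'v) raw_trm" 'v "('n, 'e, 'v) raw_trm"
  | rIotaInv "('n, 'e, 'v) raw_trm"
  | rRhoInv "('n, 'e, 'v) raw_trm"
  | rAssocInv "('n, 'e, 'v) raw_trm" 'v "('n, 'e, 'v) raw_trm" 'v "('n, 'e, 'v) raw_trm"
  | rSeq "('n, 'e, 's, 'v) raw_rw" "('n, 'e, 's, 'v) raw_rw"
  | rRSub "('n, 'e, 's, 'v) raw_rw" 'v "('n, 'e, 's, 'v) raw_rw"
  for map: rename_rw

primrec fv_rw :: "('n, 'e, 's, 'v) raw_rw \<Rightarrow> 'v set" where
  "fv_rw (rIdent t) = fv_trm t"
| "fv_rw (rSurface A B c c' \<sigma> x) = {x}"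
| "fv_rw (rIota t) = fv_trm t"
| "fv_rw (rRho u) = fv_trm u"
| "fv_rw (rAssoc t y v x u) = (fv_trm t - {y}) \<union> (fv_trm v - {x}) \<union> fv_trm u"
| "fv_rw (rIotaInv t) = fv_trm t"
| "fv_rw (rRhoInv u) = fv_trm u"
| "fv_rw (rAssocInv t y v x u) = (fv_trm t - {y}) \<union> (fv_trm v - {x}) \<union> fv_trm u"
| "fv_rw (rSeq \<tau>' \<tau>) = fv_rw \<tau>' \<union> fv_rw \<tau>"
| "fv_rw (rRSub \<tau> x \<sigma>) = (fv_rw \<tau> - {x}) \<union> fv_rw \<sigma>"

inductive alpha_rw :: "('n, 'e, 's, var) raw_rw \<Rightarrow> ('n, 'e, 's, var) raw_rw \<Rightarrow> bool" where
  refl: "alpha_rw \<tau> \<tau>"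
| sym: "alpha_rw \<tau> \<tau>' \<Longrightarrow> alpha_rw \<tau>' \<tau>"
| trans: "\<lbrakk>alpha_rw \<tau> \<tau>'; alpha_rw \<tau>' \<tau>''\<rbrakk> \<Longrightarrow> alpha_rw \<tau> \<tau>''"
| Ident: "alpha_trm t t' \<Longrightarrow> alpha_rw (rIdent t) (rIdent t')"
| Iota: "alpha_trm t t' \<Longrightarrow> alpha_rw (rIota t) (rIota t')"
| Rho: "alpha_trm u u' \<Longrightarrow> alpha_rw (rRho u) (rRho u')"
| Assoc: "\<lbrakk>alpha_trm t t'; alpha_trm v v'; alpha_trm u u'\<rbrakk> \<Longrightarrow>
    alpha_rw (rAssoc t y v x u) (rAssoc t' y v' x u')"
| IotaInv: "alpha_trm t t' \<Longrightarrow> alpha_rw (rIotaInv t) (rIotaInv t')"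
| RhoInv: "alpha_trm u u' \<Longrightarrow> alpha_rw (rRhoInv u) (rRhoInv u')"
| AssocInv: "\<lbrakk>alpha_trm t t'; alpha_trm v v'; alpha_trm u u'\<rbrakk> \<Longrightarrow>
    alpha_rw (rAssocInv t y v x u) (rAssocInv t' y v' x u')"
| Seq: "\<lbrakk>alpha_rw \<tau>1 \<tau>1'; alpha_rw \<tau>2 \<tau>2'\<rbrakk> \<Longrightarrow> alpha_rw (rSeq \<tau>1 \<tau>2) (rSeq \<tau>1' \<tau>2')"
| RSub: "\<lbrakk>alpha_rw \<tau> \<tau>'; alpha_rw \<sigma> \<sigma>'\<rbrakk> \<Longrightarrow> alpha_rw (rRSub \<tau> x \<sigma>) (rRSub \<tau>' x \<sigma>')"
| rebind: "z \<notin> fv_rw \<tau> \<Longrightarrow>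
    alpha_rw (rRSub \<tau> x \<sigma>) (rRSub (rename_rw (transpose x z) \<tau>) z \<sigma>)"
| rebind_Assoc1: "z \<notin> fv_trm t \<Longrightarrow>
    alpha_rw (rAssoc t y v x u) (rAssoc (rename_trm (transpose y z) t) z v x u)"
| rebind_Assoc2: "z \<notin> fv_trm v \<Longrightarrow>
    alpha_rw (rAssoc t y v x u) (rAssoc t y (rename_trm (transpose x z) v) z u)"
| rebind_AssocInv1: "z \<notin> fv_trm t \<Longrightarrow>
    alpha_rw (rAssocInv t y v x u) (rAssocInv (rename_trm (transpose y z) t) z v x u)"
| rebind_AssocInv2: "z \<notin> fv_trm v \<Longrightarrow>
    alpha_rw (rAssocInv t y v x u) (rAssocInv t y (rename_trm (transpose x z) v) z u)"

quotient_type ('n, 'e) trm = "('n, 'e, var) raw_trm" / alpha_trm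
  by (intro equivpI reflpI sympI transpI)
     (auto intro: alpha_trm.refl alpha_trm.sym alpha_trm.trans)

quotient_type ('n, 'e, 's) rw = "('n, 'e, 's, var) raw_rw" / alpha_rw
  by (intro equivpI reflpI sympI transpI)
     (auto intro: alpha_rw.refl alpha_rw.sym alpha_rw.trans)

lift_definition Var :: "var \<Rightarrow> ('n, 'e) trm" is rVar .

lift_definition Cst :: "'n \<Rightarrow> 'n \<Rightarrow> 'e \<Rightarrow> var \<Rightarrow> ('n, 'e) trm" is rCst .

lift_definition Sub :: "('n, 'e) trm \<Rightarrow> var \<Rightarrow> ('n, 'e) trm \<Rightarrow> ('n, 'e) trm"
  ("_\<lbrace>_ \<mapsto> _\<rbrace>" [200, 0, 0] 200) is rSub
  by (rule alpha_trm.Sub)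

lift_definition Ident :: "('n, 'e) trm \<Rightarrow> ('n, 'e, 's) rw" is rIdent
  by (rule alpha_rw.Ident)

lift_definition Surface :: "'n \<Rightarrow> 'n \<Rightarrow> 'e \<Rightarrow> 'e \<Rightarrow> 's \<Rightarrow> var \<Rightarrow> ('n, 'e, 's) rw" is rSurface .

lift_definition Iota :: "('n, 'e) trm \<Rightarrow> ('n, 'e, 's) rw" is rIota
  by (rule alpha_rw.Iota)

lift_definition Rho :: "('n, 'e) trm \<Rightarrow> ('n, 'e, 's) rw" is rRho
  by (rule alpha_rw.Rho)

lift_definition Assoc ::
  "('n, 'e) trm \<Rightarrow> var \<Rightarrow> ('n, 'e) trm \<Rightarrow> var \<Rightarrow> ('n, 'e) trm \<Rightarrow> ('n, 'e, 's) rw" is rAssoc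
  by (rule alpha_rw.Assoc)

lift_definition IotaInv :: "('n, 'e) trm \<Rightarrow> ('n, 'e, 's) rw" is rIotaInv
  by (rule alpha_rw.IotaInv)

lift_definition RhoInv :: "('n, 'e) trm \<Rightarrow> ('n, 'e, 's) rw" is rRhoInv
  by (rule alpha_rw.RhoInv)

lift_definition AssocInv ::
  "('n, 'e) trm \<Rightarrow> var \<Rightarrow> ('n, 'e) trm \<Rightarrow> var \<Rightarrow> ('n, 'e) trm \<Rightarrow> ('n, 'e, 's) rw" is rAssocInv
  by (rule alpha_rw.AssocInv)

lift_definition Seq :: "('n, 'e, 's) rw \<Rightarrow> ('n, 'e, 's) rw \<Rightarrow> ('n, 'e, 's) rw"
  (infixr "\<bullet>" 70) is rSeq
  by (rule alpha_rw.Seq)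

lift_definition RSub :: "('n, 'e, 's) rw \<Rightarrow> var \<Rightarrow> ('n, 'e, 's) rw \<Rightarrow> ('n, 'e, 's) rw"
  ("_\<llangle>_ \<mapsto> _\<rrangle>" [200, 0, 0] 200) is rRSub
  by (rule alpha_rw.RSub)


section \<open>Judgements\<close>

text \<open>
  \<open>wt_trm G x A t B\<close> is \<open>x : A \<turnstile> t : B\<close>; \<open>wt_rw G x A \<tau> t t' B\<close> is
  \<open>x : A \<turnstile> \<tau> : t \<Rightarrow> t' : B\<close>; \<open>eq_rw G x A \<tau> \<tau>' t t' B\<close> is
  \<open>x : A \<turnstile> \<tau> \<equiv> \<tau>' : t \<Rightarrow> t' : B\<close>.
\<close>

inductive wt_trm :: "('n, 'e, 's) two_graph \<Rightarrow> var \<Rightarrow> 'n \<Rightarrow> ('n, 'e) trm \<Rightarrow> 'n \<Rightarrow> bool"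
  for G :: "('n, 'e, 's) two_graph" where
  Var: "A \<in> Node G \<Longrightarrow> wt_trm G x A (Var x) A"
| Cst: "\<lbrakk>A \<in> Node G; B \<in> Node G; c \<in> Edge G A B\<rbrakk> \<Longrightarrow> wt_trm G x A (Cst A B c x) B"
| Sub: "\<lbrakk>wt_trm G x A t B; wt_trm G y D u A\<rbrakk> \<Longrightarrow> wt_trm G y D (t\<lbrace>x \<mapsto> u\<rbrace>) B"

inductive wt_rw ::
  "('n, 'e, 's) two_graph \<Rightarrow> var \<Rightarrow> 'n \<Rightarrow> ('n, 'e, 's) rw \<Rightarrow> ('n, 'e) trm \<Rightarrow> ('n, 'e) trm \<Rightarrow> 'n \<Rightarrow> bool"
  for G :: "('n, 'e, 's) two_graph" where
  Ident: "wt_trm G x A t B \<Longrightarrow> wt_rw G x A (Ident t) t t B"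
| Surface: "\<lbrakk>A \<in> Node G; B \<in> Node G; c \<in> Edge G A B; c' \<in> Edge G A B; \<sigma> \<in> Surf G A B c c'\<rbrakk> \<Longrightarrow>
    wt_rw G x A (Surface A B c c' \<sigma> x) (Cst A B c x) (Cst A B c' x) B"
| Iota: "wt_trm G x A t B \<Longrightarrow> wt_rw G x A (Iota t) t (t\<lbrace>x \<mapsto> Var x\<rbrace>) B"
| Rho: "wt_trm G y D u A \<Longrightarrow> wt_rw G y D (Rho u) (Var x\<lbrace>x \<mapsto> u\<rbrace>) u A"
| Assoc: "\<lbrakk>wt_trm G y B t C; wt_trm G x A v B; wt_trm G z D u A\<rbrakk> \<Longrightarrow>
    wt_rw G z D (Assoc t y v x u) (t\<lbrace>y \<mapsto> v\<rbrace>\<lbrace>x \<mapsto> u\<rbrace>) (t\<lbrace>y \<mapsto> v\<lbrace>x \<mapsto> u\<rbrace>\<rbrace>) C"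
| IotaInv: "wt_trm G x A t B \<Longrightarrow> wt_rw G x A (IotaInv t) (t\<lbrace>x \<mapsto> Var x\<rbrace>) t B"
| RhoInv: "wt_trm G y D u A \<Longrightarrow> wt_rw G y D (RhoInv u) u (Var x\<lbrace>x \<mapsto> u\<rbrace>) A"
| AssocInv: "\<lbrakk>wt_trm G y B t C; wt_trm G x A v B; wt_trm G z D u A\<rbrakk> \<Longrightarrow>
    wt_rw G z D (AssocInv t y v x u) (t\<lbrace>y \<mapsto> v\<lbrace>x \<mapsto> u\<rbrace>\<rbrace>) (t\<lbrace>y \<mapsto> v\<rbrace>\<lbrace>x \<mapsto> u\<rbrace>) C"
| Seq: "\<lbrakk>wt_rw G x A \<tau> t t' B; wt_rw G x A \<tau>' t' t'' B\<rbrakk> \<Longrightarrow> wt_rw G x A (\<tau>' \<bullet> \<tau>) t t'' B"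
| RSub: "\<lbrakk>wt_rw G x A \<tau> t t' B; wt_rw G y D \<sigma> u u' A\<rbrakk> \<Longrightarrow>
    wt_rw G y D (\<tau>\<llangle>x \<mapsto> \<sigma>\<rrangle>) (t\<lbrace>x \<mapsto> u\<rbrace>) (t'\<lbrace>x \<mapsto> u'\<rbrace>) B"

inductive eq_rw ::
  "('n, 'e, 's) two_graph \<Rightarrow> var \<Rightarrow> 'n \<Rightarrow> ('n, 'e, 's) rw \<Rightarrow> ('n, 'e, 's) rw \<Rightarrow>
   ('n, 'e) trm \<Rightarrow> ('n, 'e) trm \<Rightarrow> 'n \<Rightarrow> bool"
  for G :: "('n, 'e, 's) two_graph" where
  \<comment> \<open>congruence\<close>
  refl: "wt_rw G x A \<tau> t t' B \<Longrightarrow> eq_rw G x A \<tau> \<tau> t t' B"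
| sym: "eq_rw G x A \<tau> \<tau>' t t' B \<Longrightarrow> eq_rw G x A \<tau>' \<tau> t t' B"
| trans: "\<lbrakk>eq_rw G x A \<tau> \<tau>' t t' B; eq_rw G x A \<tau>' \<tau>'' t t' B\<rbrakk> \<Longrightarrow> eq_rw G x A \<tau> \<tau>'' t t' B"
| Seq: "\<lbrakk>eq_rw G x A \<tau>1 \<tau>2 t t' B; eq_rw G x A \<tau>1' \<tau>2' t' t'' B\<rbrakk> \<Longrightarrow>
    eq_rw G x A (\<tau>1' \<bullet> \<tau>1) (\<tau>2' \<bullet> \<tau>2) t t'' B"
| RSub: "\<lbrakk>eq_rw G x A \<tau>1 \<tau>2 t t' B; eq_rw G y D \<sigma>1 \<sigma>2 u u' A\<rbrakk> \<Longrightarrow>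
    eq_rw G y D (\<tau>1\<llangle>x \<mapsto> \<sigma>1\<rrangle>) (\<tau>2\<llangle>x \<mapsto> \<sigma>2\<rrangle>) (t\<lbrace>x \<mapsto> u\<rbrace>) (t'\<lbrace>x \<mapsto> u'\<rbrace>) B"
  \<comment> \<open>category laws\<close>
| Seq_assoc: "\<lbrakk>wt_rw G x A \<tau> t t' B; wt_rw G x A \<tau>' t' t'' B; wt_rw G x A \<tau>'' t'' t''' B\<rbrakk> \<Longrightarrow>
    eq_rw G x A ((\<tau>'' \<bullet> \<tau>') \<bullet> \<tau>) (\<tau>'' \<bullet> (\<tau>' \<bullet> \<tau>)) t t''' B"
| Ident_left: "wt_rw G x A \<tau> t t' B \<Longrightarrow> eq_rw G x A (Ident t' \<bullet> \<tau>) \<tau> t t' B"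
| Ident_right: "wt_rw G x A \<tau> t t' B \<Longrightarrow> eq_rw G x A (\<tau> \<bullet> Ident t) \<tau> t t' B"
  \<comment> \<open>functoriality of substitution\<close>
| RSub_Ident: "\<lbrakk>wt_trm G x A t B; wt_trm G y D u A\<rbrakk> \<Longrightarrow>
    eq_rw G y D (Ident t\<llangle>x \<mapsto> Ident u\<rrangle>) (Ident (t\<lbrace>x \<mapsto> u\<rbrace>)) (t\<lbrace>x \<mapsto> u\<rbrace>) (t\<lbrace>x \<mapsto> u\<rbrace>) B"
| interchange: "\<lbrakk>wt_rw G x A \<tau> t t' B; wt_rw G x A \<tau>' t' t'' B;
     wt_rw G y D \<sigma> u u' A; wt_rw G y D \<sigma>' u' u'' A\<rbrakk> \<Longrightarrow>
    eq_rw G y D (\<tau>'\<llangle>x \<mapsto> \<sigma>'\<rrangle> \<bullet> \<tau>\<llangle>x \<mapsto> \<sigma>\<rrangle>) ((\<tau>' \<bullet> \<tau>)\<llangle>x \<mapsto> \<sigma>' \<bullet> \<sigma>\<rrangle>)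
      (t\<lbrace>x \<mapsto> u\<rbrace>) (t''\<lbrace>x \<mapsto> u''\<rbrace>) B"
  \<comment> \<open>naturality\<close>
| Rho_natural: "wt_rw G y D \<sigma> u u' A \<Longrightarrow>
    eq_rw G y D (Rho u' \<bullet> Ident (Var x)\<llangle>x \<mapsto> \<sigma>\<rrangle>) (\<sigma> \<bullet> Rho u) (Var x\<lbrace>x \<mapsto> u\<rbrace>) u' A"
| Iota_natural: "wt_rw G x A \<tau> t t' B \<Longrightarrow>
    eq_rw G x A (Iota t' \<bullet> \<tau>) (\<tau>\<llangle>x \<mapsto> Ident (Var x)\<rrangle> \<bullet> Iota t) t (t'\<lbrace>x \<mapsto> Var x\<rbrace>) B"
| Assoc_natural: "\<lbrakk>wt_rw G y B \<tau> t t' C; wt_rw G x A \<sigma> v v' B; wt_rw G z D \<mu> u u' A\<rbrakk> \<Longrightarrow>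
    eq_rw G z D (Assoc t' y v' x u' \<bullet> \<tau>\<llangle>y \<mapsto> \<sigma>\<rrangle>\<llangle>x \<mapsto> \<mu>\<rrangle>)
      (\<tau>\<llangle>y \<mapsto> \<sigma>\<llangle>x \<mapsto> \<mu>\<rrangle>\<rrangle> \<bullet> Assoc t y v x u)
      (t\<lbrace>y \<mapsto> v\<rbrace>\<lbrace>x \<mapsto> u\<rbrace>) (t'\<lbrace>y \<mapsto> v'\<lbrace>x \<mapsto> u'\<rbrace>\<rbrace>) C"
  \<comment> \<open>triangle and pentagon\<close>
| triangle: "\<lbrakk>wt_trm G x A t B; wt_trm G y D u A\<rbrakk> \<Longrightarrow>
    eq_rw G y D (Ident t\<llangle>x \<mapsto> Rho u\<rrangle> \<bullet> Assoc t x (Var x) x u \<bullet> Iota t\<llangle>x \<mapsto> Ident u\<rrangle>)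
      (Ident (t\<lbrace>x \<mapsto> u\<rbrace>)) (t\<lbrace>x \<mapsto> u\<rbrace>) (t\<lbrace>x \<mapsto> u\<rbrace>) B"
| pentagon: "\<lbrakk>wt_trm G z C t D; wt_trm G y B w C; wt_trm G x A v B; wt_trm G r E u A\<rbrakk> \<Longrightarrow>
    eq_rw G r E
      (Ident t\<llangle>z \<mapsto> Assoc w y v x u\<rrangle> \<bullet> Assoc t z (w\<lbrace>y \<mapsto> v\<rbrace>) x u \<bullet>
        Assoc t z w y v\<llangle>x \<mapsto> Ident u\<rrangle>)
      (Assoc t z w y (v\<lbrace>x \<mapsto> u\<rbrace>) \<bullet> Assoc (t\<lbrace>z \<mapsto> w\<rbrace>) y v x u)
      (t\<lbrace>z \<mapsto> w\<rbrace>\<lbrace>y \<mapsto> v\<rbrace>\<lbrace>x \<mapsto> u\<rbrace>) (t\<lbrace>z \<mapsto> w\<lbrace>y \<mapsto> v\<lbrace>x \<mapsto> u\<rbrace>\<rbrace>\<rbrace>) D"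
  \<comment> \<open>inverses\<close>
| Iota_IotaInv: "wt_trm G x A t B \<Longrightarrow>
    eq_rw G x A (Iota t \<bullet> IotaInv t) (Ident (t\<lbrace>x \<mapsto> Var x\<rbrace>)) (t\<lbrace>x \<mapsto> Var x\<rbrace>) (t\<lbrace>x \<mapsto> Var x\<rbrace>) B"
| IotaInv_Iota: "wt_trm G x A t B \<Longrightarrow>
    eq_rw G x A (IotaInv t \<bullet> Iota t) (Ident t) t t B"
| Rho_RhoInv: "wt_trm G y D u A \<Longrightarrow>
    eq_rw G y D (Rho u \<bullet> RhoInv u) (Ident u) u u A"
| RhoInv_Rho: "wt_trm G y D u A \<Longrightarrow>
    eq_rw G y D (RhoInv u \<bullet> Rho u) (Ident (Var x\<lbrace>x \<mapsto> u\<rbrace>)) (Var x\<lbrace>x \<mapsto> u\<rbrace>) (Var x\<lbrace>x \<mapsto> u\<rbrace>) A"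
| Assoc_AssocInv: "\<lbrakk>wt_trm G y B t C; wt_trm G x A v B; wt_trm G z D u A\<rbrakk> \<Longrightarrow>
    eq_rw G z D (Assoc t y v x u \<bullet> AssocInv t y v x u) (Ident (t\<lbrace>y \<mapsto> v\<lbrace>x \<mapsto> u\<rbrace>\<rbrace>))
      (t\<lbrace>y \<mapsto> v\<lbrace>x \<mapsto> u\<rbrace>\<rbrace>) (t\<lbrace>y \<mapsto> v\<lbrace>x \<mapsto> u\<rbrace>\<rbrace>) C"
| AssocInv_Assoc: "\<lbrakk>wt_trm G y B t C; wt_trm G x A v B; wt_trm G z D u A\<rbrakk> \<Longrightarrow>
    eq_rw G z D (AssocInv t y v x u \<bullet> Assoc t y v x u) (Ident (t\<lbrace>y \<mapsto> v\<rbrace>\<lbrace>x \<mapsto> u\<rbrace>))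
      (t\<lbrace>y \<mapsto> v\<rbrace>\<lbrace>x \<mapsto> u\<rbrace>) (t\<lbrace>y \<mapsto> v\<rbrace>\<lbrace>x \<mapsto> u\<rbrace>) C"


section \<open>The syntactic bicategory\<close>

definition rw_class ::
  "('n, 'e, 's) two_graph \<Rightarrow> var \<Rightarrow> 'n \<Rightarrow> 'n \<Rightarrow> ('n, 'e, 's) rw \<Rightarrow> ('n, 'e, 's) rw set" where
  "rw_class G x A B \<tau> = {\<tau>'. \<exists>t t'. eq_rw G x A \<tau> \<tau>' t t' B}"

text \<open>
  The variable \<open>x\<close> being fixed, the object \<open>(x : A)\<close> is represented by \<open>A\<close>. Compositions of
  classes are unions over representatives.
\<close>

definition Syn :: "('n, 'e, 's) two_graph \<Rightarrow> var \<Rightarrow> ('n, ('n, 'e) trm, ('n, 'e, 's) rw set) bicat" where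
  "Syn G x =
    \<lparr>Node = Node G,
     Edge = \<lambda>A B. {t. wt_trm G x A t B},
     Surf = \<lambda>A B t t'. {rw_class G x A B \<tau> |\<tau>. wt_rw G x A \<tau> t t' B},
     Id1 = \<lambda>A. Var x,
     Comp1 = \<lambda>A B C t u. t\<lbrace>x \<mapsto> u\<rbrace>,
     Id2 = \<lambda>A B t. rw_class G x A B (Ident t),
     VComp = \<lambda>A B \<beta> \<alpha>. \<Union>\<tau>'\<in>\<beta>. \<Union>\<tau>\<in>\<alpha>. rw_class G x A B (\<tau>' \<bullet> \<tau>),
     HComp = \<lambda>A B C \<beta> \<alpha>. \<Union>\<tau>\<in>\<beta>. \<Union>\<sigma>\<in>\<alpha>. rw_class G x A C (\<tau>\<llangle>x \<mapsto> \<sigma>\<rrangle>),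
     LUnit = \<lambda>A B u. rw_class G x A B (Rho u),
     RUnit = \<lambda>A B t. rw_class G x A B (IotaInv t),
     Asc = \<lambda>A B C D t v u. rw_class G x A D (Assoc t x v x u)\<rparr>"

definition incl ::
  "('n, 'e, 's) two_graph \<Rightarrow> var \<Rightarrow> ('n, 'e, 's, 'n, ('n, 'e) trm, ('n, 'e, 's) rw set) hom" where
  "incl G x =
    \<lparr>on_node = \<lambda>A. A,
     on_edge = \<lambda>A B c. Cst A B c x,
     on_surf = \<lambda>A B c c' \<sigma>. rw_class G x A B (Surface A B c c' \<sigma> x)\<rparr>"

end

theory Submission
  imports Defs
begin

text \<open>
  Contexts being unary, variable names carry no information: renaming \<^emph>\<open>all\<close> variables (bound ones
  included) to \<open>x\<close> is constant on alpha-classes and is the identity on terms and rewrites derivable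
  over \<open>x\<close>. Terms and rewrites over \<open>x\<close> are thus generated by the constructors binding \<open>x\<close> only,
  on which a strict pseudofunctor extending \<open>h\<close> is forced; conversely the forced values are given by
  a recursion that ignores variable names, hence respects alpha-equivalence.
\<close>

section \<open>Renaming all variables to one\<close>

text \<open>Beyond variable names, two points shape the argument. A 2-cell of \<open>Syn\<close> is
  a class whose definition quantifies the boundary existentially, so composing classes requires that
  a rewrite over \<open>x\<close> determine its source and target; these are therefore recomputed
  from the raw syntax. Moreover, the right unitor of \<open>Syn\<close> is \<open>IotaInv\<close>,
  while naturality and the triangle equation of the type theory speak of \<open>Iota\<close>. The
  corresponding bicategory laws differ from these equations by passage to inverses: in one direction
  when \<open>Syn\<close> is shown to be a bicategory, in the other when the equations are checked
  in \<open>B\<close>. In \<open>B\<close> inverses of the structural cells exist but are not named;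
  they are chosen, and uniqueness of inverses forces the values of a strict pseudofunctor on
  \<open>Iota\<close>, \<open>RhoInv\<close> and \<open>AssocInv\<close>. Finally, a derivation over
  \<open>x\<close> passes through bodies over other bound variables, so the inductions about
  boundaries and about a given pseudofunctor allow any context variable and compare after renaming
  to \<open>x\<close>.\<close>

lemma alpha_trm_rename_const:
  "alpha_trm t t' \<Longrightarrow> rename_trm (\<lambda>_. y) t = rename_trm (\<lambda>_. y) t'"
  by (induction rule: alpha_trm.induct) (simp_all add: raw_trm.map_comp comp_def)

lemma alpha_rw_rename_const:
  "alpha_rw \<tau> \<tau>' \<Longrightarrow> rename_rw (\<lambda>_. y) \<tau> = rename_rw (\<lambda>_. y) \<tau>'"
  by (induction rule: alpha_rw.induct)
     (simp_all add: raw_trm.map_comp raw_rw.map_comp comp_def alpha_trm_rename_const)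

text \<open>A function insensitive to renaming agrees on a raw term and on its collapse, and
  alpha-equivalent raw terms have literally the same collapse. Such functions are thus lifted to the
  quotient without a separate induction over \<open>alpha_trm\<close>.\<close>

lemma alpha_trm_invariant:
  fixes f :: "('n, 'e, var) raw_trm \<Rightarrow> 'b"
  assumes "\<And>g t. f (rename_trm g t) = f t" and "alpha_trm t t'"
  shows "f t = f t'"
  using assms alpha_trm_rename_const by metis

lemma alpha_rw_invariant:
  fixes f :: "('n, 'e, 's, var) raw_rw \<Rightarrow> 'b"
  assumes "\<And>g \<tau>. f (rename_rw g \<tau>) = f \<tau>" and "alpha_rw \<tau> \<tau>'"
  shows "f \<tau> = f \<tau>'"
  using assms alpha_rw_rename_const by metis

text \<open>Supplies the freshness condition of \<open>rebind\<close>: in a body collapsed to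
  \<open>x\<close>, every name other than \<open>x\<close> is fresh.\<close>

lemma fv_trm_rename_const: "fv_trm (rename_trm (\<lambda>_. x) t) \<subseteq> {x}"
  by (induction t) auto

lemma fv_rw_rename_const: "fv_rw (rename_rw (\<lambda>_. x) \<tau>) \<subseteq> {x}"
  using fv_trm_rename_const by (induction \<tau>) fastforce+

lemma transpose_rename_const_trm:
  "rename_trm (transpose x y) (rename_trm (\<lambda>_. x) t) = rename_trm (\<lambda>_. y) t"
  by (simp add: raw_trm.map_comp comp_def)

lemma transpose_rename_const_rw:
  "rename_rw (transpose x y) (rename_rw (\<lambda>_. x) \<tau>) = rename_rw (\<lambda>_. y) \<tau>"
  by (simp add: raw_rw.map_comp comp_def)

text \<open>All names become equal, binders included, so this is not a capture-avoiding
  substitution. On derivable terms it is harmless: in a unary context the body of a substitution has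
  no free variable besides the bound one, so no occurrence changes its binder.\<close>

lift_definition collapse_trm :: "var \<Rightarrow> ('n, 'e) trm \<Rightarrow> ('n, 'e) trm"
  is "\<lambda>x. rename_trm (\<lambda>_. x)"
  by (simp add: alpha_trm_rename_const alpha_trm.refl)

lift_definition collapse_rw :: "var \<Rightarrow> ('n, 'e, 's) rw \<Rightarrow> ('n, 'e, 's) rw"
  is "\<lambda>x. rename_rw (\<lambda>_. x)"
  by (simp add: alpha_rw_rename_const alpha_rw.refl)

lemma collapse_trm_simps [simp]:
  "collapse_trm x (Var y) = Var x"
  "collapse_trm x (Cst A B c y) = Cst A B c x"
  "collapse_trm x (t\<lbrace>y \<mapsto> u\<rbrace>) = collapse_trm x t\<lbrace>x \<mapsto> collapse_trm x u\<rbrace>"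
  by (transfer; simp add: alpha_trm.refl)+

lemma collapse_rw_simps [simp]:
  "collapse_rw x (Ident t) = Ident (collapse_trm x t)"
  "collapse_rw x (Surface A B c c' \<sigma> y) = Surface A B c c' \<sigma> x"
  "collapse_rw x (Iota t) = Iota (collapse_trm x t)"
  "collapse_rw x (Rho u) = Rho (collapse_trm x u)"
  "collapse_rw x (Assoc t y v z u) =
     Assoc (collapse_trm x t) x (collapse_trm x v) x (collapse_trm x u)"
  "collapse_rw x (IotaInv t) = IotaInv (collapse_trm x t)"
  "collapse_rw x (RhoInv u) = RhoInv (collapse_trm x u)"
  "collapse_rw x (AssocInv t y v z u) =
     AssocInv (collapse_trm x t) x (collapse_trm x v) x (collapse_trm x u)"
  "collapse_rw x (\<tau>' \<bullet> \<tau>) = collapse_rw x \<tau>' \<bullet> collapse_rw x \<tau>"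
  "collapse_rw x (\<tau>\<llangle>y \<mapsto> \<mu>\<rrangle>) = collapse_rw x \<tau>\<llangle>x \<mapsto> collapse_rw x \<mu>\<rrangle>"
  by (transfer; simp add: alpha_rw.refl)+

text \<open>For distinct \<open>x\<close> and \<open>y\<close>, the name \<open>y\<close> is fresh
  in a body collapsed to \<open>x\<close>, so the binder may be renamed, and transposing the two
  names yields the collapse to \<open>y\<close>. For \<open>x = y\<close> freshness may fail, hence
  the case split.\<close>

lemma Sub_collapse: "collapse_trm x t\<lbrace>x \<mapsto> u\<rbrace> = collapse_trm y t\<lbrace>y \<mapsto> u\<rbrace>"
proof transfer
  fix x t u y
  show "alpha_trm (rSub (rename_trm (\<lambda>_. x) t) x u) (rSub (rename_trm (\<lambda>_. y) t) y u)"
    using alpha_trm.rebind[of y "rename_trm (\<lambda>_. x) t" x u] fv_trm_rename_const[of x t]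
    by (cases "x = y") (auto simp: transpose_rename_const_trm alpha_trm.refl)
qed

lemma RSub_collapse: "collapse_rw x \<tau>\<llangle>x \<mapsto> \<sigma>\<rrangle> = collapse_rw y \<tau>\<llangle>y \<mapsto> \<sigma>\<rrangle>"
proof transfer
  fix x \<tau> \<sigma> y
  show "alpha_rw (rRSub (rename_rw (\<lambda>_. x) \<tau>) x \<sigma>) (rRSub (rename_rw (\<lambda>_. y) \<tau>) y \<sigma>)"
    using alpha_rw.rebind[of y "rename_rw (\<lambda>_. x) \<tau>" x \<sigma>] fv_rw_rename_const[of x \<tau>]
    by (cases "x = y") (auto simp: transpose_rename_const_rw alpha_rw.refl)
qed

lemma Assoc_collapse1: "Assoc (collapse_trm y t) y v x u = Assoc (collapse_trm z t) z v x u"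
proof transfer
  fix y t v x u z
  show "alpha_rw (rAssoc (rename_trm (\<lambda>_. y) t) y v x u) (rAssoc (rename_trm (\<lambda>_. z) t) z v x u)"
    using alpha_rw.rebind_Assoc1[of z "rename_trm (\<lambda>_. y) t" y v x u] fv_trm_rename_const[of y t]
    by (cases "y = z") (auto simp: transpose_rename_const_trm alpha_rw.refl)
qed

lemma Assoc_collapse2: "Assoc t y (collapse_trm x v) x u = Assoc t y (collapse_trm z v) z u"
proof transfer
  fix t y x v u z
  show "alpha_rw (rAssoc t y (rename_trm (\<lambda>_. x) v) x u) (rAssoc t y (rename_trm (\<lambda>_. z) v) z u)"
    using alpha_rw.rebind_Assoc2[of z "rename_trm (\<lambda>_. x) v" t y x u] fv_trm_rename_const[of x v]
    by (cases "x = z") (auto simp: transpose_rename_const_trm alpha_rw.refl)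
qed

lemma AssocInv_collapse1:
  "AssocInv (collapse_trm y t) y v x u = AssocInv (collapse_trm z t) z v x u"
proof transfer
  fix y t v x u z
  show "alpha_rw (rAssocInv (rename_trm (\<lambda>_. y) t) y v x u)
    (rAssocInv (rename_trm (\<lambda>_. z) t) z v x u)"
    using alpha_rw.rebind_AssocInv1[of z "rename_trm (\<lambda>_. y) t" y v x u]
      fv_trm_rename_const[of y t]
    by (cases "y = z") (auto simp: transpose_rename_const_trm alpha_rw.refl)
qed

lemma AssocInv_collapse2:
  "AssocInv t y (collapse_trm x v) x u = AssocInv t y (collapse_trm z v) z u"
proof transfer
  fix t y x v u z
  show "alpha_rw (rAssocInv t y (rename_trm (\<lambda>_. x) v) x u)
    (rAssocInv t y (rename_trm (\<lambda>_. z) v) z u)"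
    using alpha_rw.rebind_AssocInv2[of z "rename_trm (\<lambda>_. x) v" t y x u]
      fv_trm_rename_const[of x v]
    by (cases "x = z") (auto simp: transpose_rename_const_trm alpha_rw.refl)
qed

lemma wt_trm_nodes: "wt_trm G x A t B \<Longrightarrow> A \<in> Node G \<and> B \<in> Node G"
  by (induction rule: wt_trm.induct) auto

lemma wt_rw_trm: "wt_rw G x A \<tau> t t' B \<Longrightarrow> wt_trm G x A t B \<and> wt_trm G x A t' B"
  by (induction rule: wt_rw.induct) (auto intro: wt_trm.intros dest: wt_trm_nodes)

lemma wt_trm_collapse: "wt_trm G y A t B \<Longrightarrow> wt_trm G x A (collapse_trm x t) B"
  by (induction rule: wt_trm.induct) (auto intro: wt_trm.intros)

lemma wt_rw_collapse:
  "wt_rw G y A \<tau> t t' B \<Longrightarrow>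
   wt_rw G x A (collapse_rw x \<tau>) (collapse_trm x t) (collapse_trm x t') B"
  by (induction rule: wt_rw.induct) (auto intro: wt_rw.intros wt_trm_collapse)

text \<open>The induction hypothesis collapses a body to its own bound variable, whereas the claim
  collapses it to the variable of the context. \<open>Sub_collapse\<close> passes from one to the
  other by moving the binder along.\<close>

lemma collapse_wt_trm: "wt_trm G x A t B \<Longrightarrow> collapse_trm x t = t"
proof (induction rule: wt_trm.induct)
  case (Sub x A t B y D u)
  then show ?case using Sub_collapse[of y t u x] by simp
qed auto

lemma collapse_wt_rw: "wt_rw G x A \<tau> t t' B \<Longrightarrow> collapse_rw x \<tau> = \<tau>"
proof (induction rule: wt_rw.induct)
  case (Assoc y B t C x A v z D u)
  \<comment> \<open>The two binders are independent, so each is moved to the context variable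
    \<open>z\<close> by its own rebinding rule.\<close>
  have "Assoc (collapse_trm z t) z (collapse_trm z v) z u =
    Assoc (collapse_trm y t) y (collapse_trm x v) x u"
    using Assoc_collapse1 Assoc_collapse2 by metis
  with Assoc show ?case by (simp add: collapse_wt_trm)
next
  case (AssocInv y B t C x A v z D u)
  have "AssocInv (collapse_trm z t) z (collapse_trm z v) z u =
    AssocInv (collapse_trm y t) y (collapse_trm x v) x u"
    using AssocInv_collapse1 AssocInv_collapse2 by metis
  with AssocInv show ?case by (simp add: collapse_wt_trm)
next
  case (RSub x A \<tau> t t' B y D \<sigma> u u')
  then show ?case using RSub_collapse[of y \<tau> \<sigma> x] by simp
qed (auto simp: collapse_wt_trm)


section \<open>Uniqueness of the boundary of a rewrite\<close>

text \<open>Computing the boundary with every variable renamed to \<open>x\<close> makes it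
  invariant under renaming, so that it descends to alpha-classes. It also settles the bound variable
  in the source of \<open>rRho\<close>, which the rewrite itself does not record.\<close>

primrec raw_src :: "'v \<Rightarrow> ('n, 'e, 's, 'v) raw_rw \<Rightarrow> ('n, 'e, 'v) raw_trm" where
  "raw_src x (rIdent t) = rename_trm (\<lambda>_. x) t"
| "raw_src x (rSurface A B c c' \<sigma> y) = rCst A B c x"
| "raw_src x (rIota t) = rename_trm (\<lambda>_. x) t"
| "raw_src x (rRho u) = rSub (rVar x) x (rename_trm (\<lambda>_. x) u)"
| "raw_src x (rAssoc t y v z u) =
     rename_trm (\<lambda>_. x) (rSub (rSub t x v) x u)"
| "raw_src x (rIotaInv t) = rSub (rename_trm (\<lambda>_. x) t) x (rVar x)"
| "raw_src x (rRhoInv u) = rename_trm (\<lambda>_. x) u"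
| "raw_src x (rAssocInv t y v z u) =
     rename_trm (\<lambda>_. x) (rSub t x (rSub v x u))"
| "raw_src x (rSeq \<tau>' \<tau>) = raw_src x \<tau>"
| "raw_src x (rRSub \<tau> y \<sigma>) = rSub (raw_src x \<tau>) x (raw_src x \<sigma>)"

primrec raw_tgt :: "'v \<Rightarrow> ('n, 'e, 's, 'v) raw_rw \<Rightarrow> ('n, 'e, 'v) raw_trm" where
  "raw_tgt x (rIdent t) = rename_trm (\<lambda>_. x) t"
| "raw_tgt x (rSurface A B c c' \<sigma> y) = rCst A B c' x"
| "raw_tgt x (rIota t) = rSub (rename_trm (\<lambda>_. x) t) x (rVar x)"
| "raw_tgt x (rRho u) = rename_trm (\<lambda>_. x) u"
| "raw_tgt x (rAssoc t y v z u) =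
     rename_trm (\<lambda>_. x) (rSub t x (rSub v x u))"
| "raw_tgt x (rIotaInv t) = rename_trm (\<lambda>_. x) t"
| "raw_tgt x (rRhoInv u) = rSub (rVar x) x (rename_trm (\<lambda>_. x) u)"
| "raw_tgt x (rAssocInv t y v z u) =
     rename_trm (\<lambda>_. x) (rSub (rSub t x v) x u)"
| "raw_tgt x (rSeq \<tau>' \<tau>) = raw_tgt x \<tau>'"
| "raw_tgt x (rRSub \<tau> y \<sigma>) = rSub (raw_tgt x \<tau>) x (raw_tgt x \<sigma>)"

lemma raw_src_rename: "raw_src x (rename_rw f \<tau>) = raw_src x \<tau>"
  by (induction \<tau>) (simp_all add: raw_trm.map_comp comp_def)

lemma raw_tgt_rename: "raw_tgt x (rename_rw f \<tau>) = raw_tgt x \<tau>"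
  by (induction \<tau>) (simp_all add: raw_trm.map_comp comp_def)

lift_definition src :: "var \<Rightarrow> ('n, 'e, 's) rw \<Rightarrow> ('n, 'e) trm" is raw_src
  by (metis alpha_rw_invariant raw_src_rename alpha_trm.refl)

lift_definition tgt :: "var \<Rightarrow> ('n, 'e, 's) rw \<Rightarrow> ('n, 'e) trm" is raw_tgt
  by (metis alpha_rw_invariant raw_tgt_rename alpha_trm.refl)

lemma src_simps [simp]:
  "src x (Ident t) = collapse_trm x t"
  "src x (Surface A B c c' \<sigma> y) = Cst A B c x"
  "src x (Iota t) = collapse_trm x t"
  "src x (Rho u) = Var x\<lbrace>x \<mapsto> collapse_trm x u\<rbrace>"
  "src x (Assoc t y v z u) = collapse_trm x t\<lbrace>x \<mapsto> collapse_trm x v\<rbrace>\<lbrace>x \<mapsto> collapse_trm x u\<rbrace>"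
  "src x (IotaInv t) = collapse_trm x t\<lbrace>x \<mapsto> Var x\<rbrace>"
  "src x (RhoInv u) = collapse_trm x u"
  "src x (AssocInv t y v z u) = collapse_trm x t\<lbrace>x \<mapsto> collapse_trm x v\<lbrace>x \<mapsto> collapse_trm x u\<rbrace>\<rbrace>"
  "src x (\<tau>' \<bullet> \<tau>) = src x \<tau>"
  "src x (\<tau>\<llangle>y \<mapsto> \<mu>\<rrangle>) = src x \<tau>\<lbrace>x \<mapsto> src x \<mu>\<rbrace>"
  by (transfer; simp add: alpha_trm.refl)+

lemma tgt_simps [simp]:
  "tgt x (Ident t) = collapse_trm x t"
  "tgt x (Surface A B c c' \<sigma> y) = Cst A B c' x"
  "tgt x (Iota t) = collapse_trm x t\<lbrace>x \<mapsto> Var x\<rbrace>"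
  "tgt x (Rho u) = collapse_trm x u"
  "tgt x (Assoc t y v z u) = collapse_trm x t\<lbrace>x \<mapsto> collapse_trm x v\<lbrace>x \<mapsto> collapse_trm x u\<rbrace>\<rbrace>"
  "tgt x (IotaInv t) = collapse_trm x t"
  "tgt x (RhoInv u) = Var x\<lbrace>x \<mapsto> collapse_trm x u\<rbrace>"
  "tgt x (AssocInv t y v z u) = collapse_trm x t\<lbrace>x \<mapsto> collapse_trm x v\<rbrace>\<lbrace>x \<mapsto> collapse_trm x u\<rbrace>"
  "tgt x (\<tau>' \<bullet> \<tau>) = tgt x \<tau>'"
  "tgt x (\<tau>\<llangle>y \<mapsto> \<mu>\<rrangle>) = tgt x \<tau>\<lbrace>x \<mapsto> tgt x \<mu>\<rbrace>"
  by (transfer; simp add: alpha_trm.refl)+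

text \<open>The context variable \<open>y\<close> and the collapse target \<open>x\<close> are kept
  apart because \<open>RSub\<close> passes to a body over another variable.\<close>

lemma wt_rw_boundary:
  "wt_rw G y A \<tau> t t' B \<Longrightarrow> collapse_trm x t = src x \<tau> \<and> collapse_trm x t' = tgt x \<tau>"
  by (induction rule: wt_rw.induct) auto

text \<open>Over \<open>x\<close> itself collapsing fixes derivable terms, so any boundary of the
  rewrite is the recomputed one. This makes the existential boundary in \<open>rw_class\<close>
  harmless.\<close>

lemma wt_rw_unique_boundary:
  assumes "wt_rw G x A \<tau> t t' B" and "wt_rw G x A \<tau> s s' C"
  shows "s = t \<and> s' = t'"
proof -
  have "collapse_trm x s = collapse_trm x t" "collapse_trm x s' = collapse_trm x t'"
    using wt_rw_boundary[OF assms(1), of x] wt_rw_boundary[OF assms(2), of x] by auto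
  then show ?thesis using wt_rw_trm[OF assms(1)] wt_rw_trm[OF assms(2)] collapse_wt_trm by metis
qed


section \<open>The syntactic bicategory is a bicategory\<close>

text \<open>Needed to know that every member of a class is derivable with the boundary of the
  equation, so that uniqueness of boundaries applies to it.\<close>

lemma eq_rw_wt:
  "eq_rw G x A \<tau> \<tau>' t t' B \<Longrightarrow> wt_rw G x A \<tau> t t' B \<and> wt_rw G x A \<tau>' t t' B"
proof (induction rule: eq_rw.induct)
  case (Seq x A \<tau>1 \<tau>2 t t' B \<tau>1' \<tau>2' t'')
  then show ?case by (auto intro: wt_rw.Seq)
next
  case (RSub x A \<tau>1 \<tau>2 t t' B y D \<sigma>1 \<sigma>2 u u')
  then show ?case by (auto intro: wt_rw.RSub)
next
  case (Seq_assoc x A \<tau> t t' B \<tau>' t'' \<tau>'' t''')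
  then show ?case using wt_rw.Seq[OF wt_rw.Seq] wt_rw.Seq[OF Seq_assoc(1) wt_rw.Seq] by simp
next
  case (Ident_left x A \<tau> t t' B)
  then show ?case using wt_rw_trm[OF Ident_left] by (auto intro: wt_rw.Seq[OF _ wt_rw.Ident])
next
  case (Ident_right x A \<tau> t t' B)
  then show ?case using wt_rw_trm[OF Ident_right] by (auto intro: wt_rw.Seq[OF wt_rw.Ident])
next
  case (interchange x A \<tau> t t' B \<tau>' t'' y D \<sigma> u u' \<sigma>' u'')
  note wt = interchange
  show ?case
    using wt_rw.Seq[OF wt_rw.RSub[OF wt(1,3)] wt_rw.RSub[OF wt(2,4)]]
      wt_rw.RSub[OF wt_rw.Seq[OF wt(1,2)] wt_rw.Seq[OF wt(3,4)]] by simp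
next
  case (Rho_natural y D \<sigma> u u' A x)
  then have "wt_trm G y D u A" "wt_trm G y D u' A" "wt_trm G x A (Var x) A"
    using wt_rw_trm[OF Rho_natural] by (auto intro: wt_trm.Var dest: wt_trm_nodes)
  with Rho_natural show ?case
    by (auto intro: wt_rw.Seq[OF wt_rw.RSub wt_rw.Rho] wt_rw.Seq[OF wt_rw.Rho] wt_rw.Ident)
next
  case (Iota_natural x A \<tau> t t' B)
  then have "wt_trm G x A t B" "wt_trm G x A t' B" "wt_trm G x A (Var x) A"
    using wt_rw_trm[OF Iota_natural] by (auto intro: wt_trm.Var dest: wt_trm_nodes)
  with Iota_natural show ?case
    by (auto intro: wt_rw.Seq[OF _ wt_rw.Iota] wt_rw.Seq[OF wt_rw.Iota wt_rw.RSub] wt_rw.Ident)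
next
  case (Assoc_natural y B \<tau> t t' C x A \<sigma> v v' z D \<mu> u u')
  note wt = this
  have 1: "wt_rw G z D (Assoc t y v x u) (t\<lbrace>y \<mapsto> v\<rbrace>\<lbrace>x \<mapsto> u\<rbrace>) (t\<lbrace>y \<mapsto> v\<lbrace>x \<mapsto> u\<rbrace>\<rbrace>) C"
    and 2: "wt_rw G z D (Assoc t' y v' x u') (t'\<lbrace>y \<mapsto> v'\<rbrace>\<lbrace>x \<mapsto> u'\<rbrace>) (t'\<lbrace>y \<mapsto> v'\<lbrace>x \<mapsto> u'\<rbrace>\<rbrace>) C"
    using wt[THEN wt_rw_trm] by (auto intro: wt_rw.Assoc)
  show ?case
    using wt_rw.Seq[OF wt_rw.RSub[OF wt_rw.RSub[OF wt(1,2)] wt(3)] 2]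
      wt_rw.Seq[OF 1 wt_rw.RSub[OF wt(1) wt_rw.RSub[OF wt(2,3)]]] by simp
next
  case (triangle x A t B y D u)
  then have "wt_trm G x A (Var x) A" by (auto intro: wt_trm.Var dest: wt_trm_nodes)
  with triangle show ?case
    by (auto intro: wt_rw.Ident wt_trm.Sub
        intro!: wt_rw.Seq[OF wt_rw.Seq[OF wt_rw.RSub[OF wt_rw.Iota wt_rw.Ident] wt_rw.Assoc]
          wt_rw.RSub[OF wt_rw.Ident wt_rw.Rho]])
next
  case (pentagon z C t D y B w x A v r E u)
  then show ?case
    by (auto intro: wt_trm.Sub wt_rw.Seq[OF wt_rw.Assoc wt_rw.Assoc]
        wt_rw.Seq[OF wt_rw.Seq[OF wt_rw.RSub[OF wt_rw.Assoc wt_rw.Ident] wt_rw.Assoc]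
          wt_rw.RSub[OF wt_rw.Ident wt_rw.Assoc]])
next
  case (RSub_Ident x A t B y D u)
  then show ?case by (auto intro: wt_rw.RSub wt_rw.Ident wt_trm.Sub)
next
  case (Iota_IotaInv x A t B)
  then show ?case
    by (auto intro: wt_rw.Seq[OF wt_rw.IotaInv wt_rw.Iota] wt_rw.Ident wt_trm.Sub wt_trm.Var
        dest: wt_trm_nodes)
next
  case (IotaInv_Iota x A t B)
  then show ?case by (auto intro: wt_rw.Seq[OF wt_rw.Iota wt_rw.IotaInv] wt_rw.Ident)
next
  case (Rho_RhoInv y D u A)
  then show ?case by (auto intro: wt_rw.Seq[OF wt_rw.RhoInv wt_rw.Rho] wt_rw.Ident)
next
  case (RhoInv_Rho y D u A x)
  then show ?case
    by (auto intro: wt_rw.Seq[OF wt_rw.Rho wt_rw.RhoInv] wt_rw.Ident wt_trm.Sub wt_trm.Var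
        dest: wt_trm_nodes)
next
  case (Assoc_AssocInv y B t C x A v z D u)
  then show ?case
    by (auto intro: wt_rw.Seq[OF wt_rw.AssocInv wt_rw.Assoc] wt_rw.Ident wt_trm.Sub)
next
  case (AssocInv_Assoc y B t C x A v z D u)
  then show ?case
    by (auto intro: wt_rw.Seq[OF wt_rw.Assoc wt_rw.AssocInv] wt_rw.Ident wt_trm.Sub)
qed auto

section \<open>Classes of rewrites and their composition\<close>

lemma rw_class_refl: "wt_rw G x A \<tau> t t' B \<Longrightarrow> \<tau> \<in> rw_class G x A B \<tau>"
  unfolding rw_class_def by (blast intro: eq_rw.refl)

text \<open>The boundary hidden in the class must be that of the representative. With boundaries
  matched, the congruence rules apply to arbitrary members of classes.\<close>

lemma rw_class_mem:
  assumes "wt_rw G x A \<tau> t t' B" and "\<tau>' \<in> rw_class G x A B \<tau>"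
  shows "eq_rw G x A \<tau> \<tau>' t t' B"
proof -
  obtain s s' where s: "eq_rw G x A \<tau> \<tau>' s s' B"
    using assms(2) unfolding rw_class_def by blast
  have "s = t \<and> s' = t'"
    using wt_rw_unique_boundary[OF assms(1)] eq_rw_wt[OF s] by blast
  then show ?thesis using s by simp
qed

lemma rw_class_eq:
  assumes "eq_rw G x A \<tau> \<tau>' t t' B"
  shows "rw_class G x A B \<tau> = rw_class G x A B \<tau>'"
proof -
  have "rw_class G x A B \<sigma>' \<subseteq> rw_class G x A B \<sigma>" if "eq_rw G x A \<sigma> \<sigma>' t t' B" for \<sigma> \<sigma>'
  proof
    fix \<rho> assume "\<rho> \<in> rw_class G x A B \<sigma>'"
    then have "eq_rw G x A \<sigma>' \<rho> t t' B" using eq_rw_wt[OF that] by (blast intro: rw_class_mem)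
    then show "\<rho> \<in> rw_class G x A B \<sigma>"
      using that unfolding rw_class_def by (blast intro: eq_rw.trans)
  qed
  then show ?thesis using assms by (blast intro: eq_rw.sym)
qed

lemma Syn_simps [simp]:
  "Node (Syn G x) = Node G"
  "Edge (Syn G x) A B = {t. wt_trm G x A t B}"
  "Surf (Syn G x) A B t t' = {rw_class G x A B \<tau> |\<tau>. wt_rw G x A \<tau> t t' B}"
  "Id1 (Syn G x) A = Var x"
  "Comp1 (Syn G x) A B C t u = t\<lbrace>x \<mapsto> u\<rbrace>"
  "Id2 (Syn G x) A B t = rw_class G x A B (Ident t)"
  "LUnit (Syn G x) A B u = rw_class G x A B (Rho u)"
  "RUnit (Syn G x) A B t = rw_class G x A B (IotaInv t)"
  "Asc (Syn G x) A B C D t v u = rw_class G x A D (Assoc t x v x u)"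
  by (simp_all add: Syn_def)

text \<open>Compositions in \<open>Syn\<close> are unions over all pairs of representatives.
  Congruence makes the family constant, and reflexivity provides one pair, so the union is a single
  class.\<close>

lemma UN_constant2:
  assumes "a \<in> A" "b \<in> B" "\<And>a b. \<lbrakk>a \<in> A; b \<in> B\<rbrakk> \<Longrightarrow> f a b = c"
  shows "(\<Union>a\<in>A. \<Union>b\<in>B. f a b) = c"
  using assms by auto

lemma Syn_VComp [simp]:
  assumes "wt_rw G x A \<tau> t t' B" and "wt_rw G x A \<tau>' t' t'' B"
  shows "VComp (Syn G x) A B (rw_class G x A B \<tau>') (rw_class G x A B \<tau>) = rw_class G x A B (\<tau>' \<bullet> \<tau>)"
proof -
  have "VComp (Syn G x) A B (rw_class G x A B \<tau>') (rw_class G x A B \<tau>) =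
    (\<Union>\<rho>'\<in>rw_class G x A B \<tau>'. \<Union>\<rho>\<in>rw_class G x A B \<tau>. rw_class G x A B (\<rho>' \<bullet> \<rho>))"
    by (simp add: Syn_def)
  also have "\<dots> = rw_class G x A B (\<tau>' \<bullet> \<tau>)"
  proof (rule UN_constant2[OF rw_class_refl[OF assms(2)] rw_class_refl[OF assms(1)]])
    fix \<rho>' \<rho> assume "\<rho> \<in> rw_class G x A B \<tau>" "\<rho>' \<in> rw_class G x A B \<tau>'"
    then show "rw_class G x A B (\<rho>' \<bullet> \<rho>) = rw_class G x A B (\<tau>' \<bullet> \<tau>)"
      by (rule rw_class_eq[OF eq_rw.Seq[OF rw_class_mem[OF assms(1)] rw_class_mem[OF assms(2)]],
          symmetric])
  qed
  finally show ?thesis .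
qed

lemma Syn_HComp [simp]:
  assumes "wt_rw G x A \<sigma> u u' B" and "wt_rw G x B \<tau> t t' C"
  shows "HComp (Syn G x) A B C (rw_class G x B C \<tau>) (rw_class G x A B \<sigma>) =
    rw_class G x A C (\<tau>\<llangle>x \<mapsto> \<sigma>\<rrangle>)"
proof -
  have "HComp (Syn G x) A B C (rw_class G x B C \<tau>) (rw_class G x A B \<sigma>) =
    (\<Union>\<rho>'\<in>rw_class G x B C \<tau>. \<Union>\<rho>\<in>rw_class G x A B \<sigma>. rw_class G x A C (\<rho>'\<llangle>x \<mapsto> \<rho>\<rrangle>))"
    by (simp add: Syn_def)
  also have "\<dots> = rw_class G x A C (\<tau>\<llangle>x \<mapsto> \<sigma>\<rrangle>)"
  proof (rule UN_constant2[OF rw_class_refl[OF assms(2)] rw_class_refl[OF assms(1)]])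
    fix \<rho>' \<rho> assume "\<rho>' \<in> rw_class G x B C \<tau>" "\<rho> \<in> rw_class G x A B \<sigma>"
    then show "rw_class G x A C (\<rho>'\<llangle>x \<mapsto> \<rho>\<rrangle>) = rw_class G x A C (\<tau>\<llangle>x \<mapsto> \<sigma>\<rrangle>)"
      by (rule rw_class_eq[OF eq_rw.RSub[OF rw_class_mem[OF assms(2)] rw_class_mem[OF assms(1)]],
          symmetric])
  qed
  finally show ?thesis .
qed

text \<open>The laws of one hom-category are isolated so that facts about inverses serve both
  \<open>B\<close> and \<open>Syn\<close>; for \<open>Syn\<close> they are used while its bicategory
  axioms are still being proved.\<close>

locale hom_category =
  fixes Ob :: "'a set" and Hom :: "'a \<Rightarrow> 'a \<Rightarrow> 'c set" and I :: "'a \<Rightarrow> 'c"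
    and C :: "'c \<Rightarrow> 'c \<Rightarrow> 'c"
  assumes I_Hom: "f \<in> Ob \<Longrightarrow> I f \<in> Hom f f"
    and C_Hom: "\<lbrakk>f \<in> Ob; g \<in> Ob; k \<in> Ob; \<alpha> \<in> Hom f g; \<beta> \<in> Hom g k\<rbrakk> \<Longrightarrow> C \<beta> \<alpha> \<in> Hom f k"
    and C_assoc: "\<lbrakk>f \<in> Ob; g \<in> Ob; k \<in> Ob; l \<in> Ob; \<alpha> \<in> Hom f g; \<beta> \<in> Hom g k; \<gamma> \<in> Hom k l\<rbrakk> \<Longrightarrow>
      C (C \<gamma> \<beta>) \<alpha> = C \<gamma> (C \<beta> \<alpha>)"
    and C_I_left: "\<lbrakk>f \<in> Ob; g \<in> Ob; \<alpha> \<in> Hom f g\<rbrakk> \<Longrightarrow> C (I g) \<alpha> = \<alpha>"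
    and C_I_right: "\<lbrakk>f \<in> Ob; g \<in> Ob; \<alpha> \<in> Hom f g\<rbrakk> \<Longrightarrow> C \<alpha> (I f) = \<alpha>"
begin

text \<open>The usual computation \<open>\<beta> = \<beta>(\<alpha>\<beta>') =
  (\<beta>\<alpha>)\<beta>' = \<beta>'\<close>: a left inverse equals a right inverse.\<close>

lemma inverse_unique:
  assumes "f \<in> Ob" "g \<in> Ob" "\<alpha> \<in> Hom f g" "\<beta> \<in> Hom g f" "\<beta>' \<in> Hom g f"
    and "C \<beta> \<alpha> = I f" and "C \<alpha> \<beta>' = I g"
  shows "\<beta> = \<beta>'"
  using assms C_assoc[of g f g f \<beta>' \<alpha> \<beta>] C_I_left[of g f \<beta>'] C_I_right[of g f \<beta>] by simp

text \<open>Composing the square with \<open>\<beta>'\<close> after it and \<open>\<alpha>'\<close>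
  before it cancels \<open>\<beta>\<close> and \<open>\<alpha>\<close>. This converts naturality of
  an invertible cell into naturality of its inverse.\<close>

lemma inverse_square:
  assumes ob: "f \<in> Ob" "f' \<in> Ob" "g \<in> Ob" "g' \<in> Ob"
    and \<alpha>: "\<alpha> \<in> Hom f g" "\<alpha>' \<in> Hom g f" "C \<alpha> \<alpha>' = I g"
    and \<beta>: "\<beta> \<in> Hom f' g'" "\<beta>' \<in> Hom g' f'" "C \<beta>' \<beta> = I f'"
    and \<phi>: "\<phi> \<in> Hom f f'" and \<psi>: "\<psi> \<in> Hom g g'"
    and square: "C \<beta> \<phi> = C \<psi> \<alpha>"
  shows "C \<beta>' \<psi> = C \<phi> \<alpha>'"
proof -
  have "C \<beta>' \<psi> = C \<beta>' (C (C \<psi> \<alpha>) \<alpha>')"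
    using ob \<alpha> \<psi> C_assoc[of g f g g' \<alpha>' \<alpha> \<psi>] C_I_right[of g g' \<psi>] by simp
  also have "\<dots> = C \<beta>' (C \<beta> (C \<phi> \<alpha>'))"
    using ob \<alpha> \<beta> \<phi> C_assoc[of g f f' g' \<alpha>' \<phi> \<beta>] by (simp flip: square)
  also have "\<dots> = C (C \<beta>' \<beta>) (C \<phi> \<alpha>')"
    using ob \<alpha> \<beta> \<phi> C_assoc[of g f' g' f' "C \<phi> \<alpha>'" \<beta> \<beta>'] C_Hom by simp
  also have "\<dots> = C \<phi> \<alpha>'"
    using ob \<alpha> \<beta> \<phi> C_I_left[of g f' "C \<phi> \<alpha>'"] C_Hom by simp
  finally show ?thesis .
qed

end

lemma hom_category_Syn:
  "hom_category (Edge (Syn G x) A B) (Surf (Syn G x) A B) (Id2 (Syn G x) A B) (VComp (Syn G x) A B)"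
proof
  fix f assume "f \<in> Edge (Syn G x) A B"
  then show "Id2 (Syn G x) A B f \<in> Surf (Syn G x) A B f f" by (auto intro: wt_rw.Ident)
next
  fix f g k \<alpha> \<beta>
  assume "\<alpha> \<in> Surf (Syn G x) A B f g" "\<beta> \<in> Surf (Syn G x) A B g k"
  then show "VComp (Syn G x) A B \<beta> \<alpha> \<in> Surf (Syn G x) A B f k"
    by (auto intro: wt_rw.Seq)
next
  fix f g k l \<alpha> \<beta> \<gamma>
  assume "\<alpha> \<in> Surf (Syn G x) A B f g" "\<beta> \<in> Surf (Syn G x) A B g k" "\<gamma> \<in> Surf (Syn G x) A B k l"
  then obtain \<rho> \<sigma> \<tau> where wt: "wt_rw G x A \<rho> f g B" "wt_rw G x A \<sigma> g k B" "wt_rw G x A \<tau> k l B"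
    and eq: "\<alpha> = rw_class G x A B \<rho>" "\<beta> = rw_class G x A B \<sigma>" "\<gamma> = rw_class G x A B \<tau>"
    by auto
  show "VComp (Syn G x) A B (VComp (Syn G x) A B \<gamma> \<beta>) \<alpha> =
    VComp (Syn G x) A B \<gamma> (VComp (Syn G x) A B \<beta> \<alpha>)"
    unfolding eq Syn_VComp[OF wt(1,2)] Syn_VComp[OF wt(2,3)]
      Syn_VComp[OF wt_rw.Seq[OF wt(1,2)] wt(3)] Syn_VComp[OF wt(1) wt_rw.Seq[OF wt(2,3)]]
    by (rule rw_class_eq[OF eq_rw.Seq_assoc[OF wt]])
next
  fix f g \<alpha> assume "\<alpha> \<in> Surf (Syn G x) A B f g"
  then obtain \<tau> where wt: "wt_rw G x A \<tau> f g B" and eq: "\<alpha> = rw_class G x A B \<tau>" by auto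
  have wt_id: "wt_rw G x A (Ident f) f f B" "wt_rw G x A (Ident g) g g B"
    using wt_rw_trm[OF wt] by (auto intro: wt_rw.Ident)
  show "VComp (Syn G x) A B (Id2 (Syn G x) A B g) \<alpha> = \<alpha>"
    using rw_class_eq[OF eq_rw.Ident_left[OF wt]] by (simp add: eq Syn_VComp[OF wt wt_id(2)])
  show "VComp (Syn G x) A B \<alpha> (Id2 (Syn G x) A B f) = \<alpha>"
    using rw_class_eq[OF eq_rw.Ident_right[OF wt]] by (simp add: eq Syn_VComp[OF wt_id(1) wt])
qed

section \<open>The bicategory axioms for \<open>Syn\<close>\<close>

lemma iso_cell_Syn:
  assumes "wt_rw G x A \<tau> t t' B" "wt_rw G x A \<tau>' t' t B"
    and "eq_rw G x A (\<tau>' \<bullet> \<tau>) (Ident t) t t B" "eq_rw G x A (\<tau> \<bullet> \<tau>') (Ident t') t' t' B"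
  shows "iso_cell (Syn G x) A B t t' (rw_class G x A B \<tau>)"
  unfolding iso_cell_def
proof (intro conjI bexI)
  show "VComp (Syn G x) A B (rw_class G x A B \<tau>') (rw_class G x A B \<tau>) = Id2 (Syn G x) A B t"
    using rw_class_eq[OF assms(3)] by (simp add: Syn_VComp[OF assms(1,2)])
  show "VComp (Syn G x) A B (rw_class G x A B \<tau>) (rw_class G x A B \<tau>') = Id2 (Syn G x) A B t'"
    using rw_class_eq[OF assms(4)] by (simp add: Syn_VComp[OF assms(2,1)])
qed (use assms(1,2) in auto)

lemma Surf_SynI: "wt_rw G x A \<tau> t t' B \<Longrightarrow> rw_class G x A B \<tau> \<in> Surf (Syn G x) A B t t'"
  by auto

lemma Surf_SynE:
  assumes "\<alpha> \<in> Surf (Syn G x) A B t t'"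
  obtains \<tau> where "wt_rw G x A \<tau> t t' B" "\<alpha> = rw_class G x A B \<tau>"
  using assms by auto

text \<open>Once compositions of classes are computed on representatives, most axioms are rules of
  \<open>eq_rw\<close>, up to symmetry. The exceptions are naturality of the right unitor and the
  triangle law, where \<open>IotaInv\<close> must be traded for \<open>Iota\<close>.\<close>

lemma bicategory_Syn: "bicategory (Syn G x)"
proof
  fix X Y f assume "f \<in> Edge (Syn G x) X Y"
  then show "Id2 (Syn G x) X Y f \<in> Surf (Syn G x) X Y f f"
    by (rule hom_category.I_Hom[OF hom_category_Syn])
next
  fix X Y f g k \<alpha> \<beta>
  assume "f \<in> Edge (Syn G x) X Y" "g \<in> Edge (Syn G x) X Y" "k \<in> Edge (Syn G x) X Y"
    "\<alpha> \<in> Surf (Syn G x) X Y f g" "\<beta> \<in> Surf (Syn G x) X Y g k"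
  then show "VComp (Syn G x) X Y \<beta> \<alpha> \<in> Surf (Syn G x) X Y f k"
    by (rule hom_category.C_Hom[OF hom_category_Syn])
next
  fix X Y f g k l \<alpha> \<beta> \<gamma>
  assume "f \<in> Edge (Syn G x) X Y" "g \<in> Edge (Syn G x) X Y" "k \<in> Edge (Syn G x) X Y"
    "l \<in> Edge (Syn G x) X Y" "\<alpha> \<in> Surf (Syn G x) X Y f g" "\<beta> \<in> Surf (Syn G x) X Y g k"
    "\<gamma> \<in> Surf (Syn G x) X Y k l"
  then show "VComp (Syn G x) X Y (VComp (Syn G x) X Y \<gamma> \<beta>) \<alpha> =
    VComp (Syn G x) X Y \<gamma> (VComp (Syn G x) X Y \<beta> \<alpha>)"
    by (rule hom_category.C_assoc[OF hom_category_Syn])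
next
  fix X Y f g \<alpha>
  assume "f \<in> Edge (Syn G x) X Y" "g \<in> Edge (Syn G x) X Y" "\<alpha> \<in> Surf (Syn G x) X Y f g"
  then show "VComp (Syn G x) X Y (Id2 (Syn G x) X Y g) \<alpha> = \<alpha>"
    by (rule hom_category.C_I_left[OF hom_category_Syn])
next
  fix X Y f g \<alpha>
  assume "f \<in> Edge (Syn G x) X Y" "g \<in> Edge (Syn G x) X Y" "\<alpha> \<in> Surf (Syn G x) X Y f g"
  then show "VComp (Syn G x) X Y \<alpha> (Id2 (Syn G x) X Y f) = \<alpha>"
    by (rule hom_category.C_I_right[OF hom_category_Syn])
next
  fix X assume "X \<in> Node (Syn G x)"
  then show "Id1 (Syn G x) X \<in> Edge (Syn G x) X X" by (simp add: wt_trm.Var)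
next
  fix X Y Z f g assume "f \<in> Edge (Syn G x) X Y" "g \<in> Edge (Syn G x) Y Z"
  then show "Comp1 (Syn G x) X Y Z g f \<in> Edge (Syn G x) X Z" by (simp add: wt_trm.Sub)
next
  fix X Y Z f f' g g' \<alpha> \<beta>
  assume "\<alpha> \<in> Surf (Syn G x) X Y f f'" "\<beta> \<in> Surf (Syn G x) Y Z g g'"
  then show "HComp (Syn G x) X Y Z \<beta> \<alpha> \<in>
    Surf (Syn G x) X Z (Comp1 (Syn G x) X Y Z g f) (Comp1 (Syn G x) X Y Z g' f')"
    by (auto intro: wt_rw.RSub)
next
  fix X Y Z f g assume "f \<in> Edge (Syn G x) X Y" "g \<in> Edge (Syn G x) Y Z"
  then have wt: "wt_trm G x X f Y" "wt_trm G x Y g Z" by simp_all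
  show "HComp (Syn G x) X Y Z (Id2 (Syn G x) Y Z g) (Id2 (Syn G x) X Y f) =
    Id2 (Syn G x) X Z (Comp1 (Syn G x) X Y Z g f)"
    using rw_class_eq[OF eq_rw.RSub_Ident[OF wt(2,1)]]
    by (simp add: Syn_HComp[OF wt_rw.Ident[OF wt(1)] wt_rw.Ident[OF wt(2)]])
next
  fix X Y Z f f' f'' g g' g'' \<alpha> \<alpha>' \<beta> \<beta>'
  assume "\<alpha> \<in> Surf (Syn G x) X Y f f'" "\<alpha>' \<in> Surf (Syn G x) X Y f' f''"
    "\<beta> \<in> Surf (Syn G x) Y Z g g'" "\<beta>' \<in> Surf (Syn G x) Y Z g' g''"
  then obtain \<sigma> \<sigma>' \<tau> \<tau>' where wt: "wt_rw G x X \<sigma> f f' Y" "wt_rw G x X \<sigma>' f' f'' Y"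
      "wt_rw G x Y \<tau> g g' Z" "wt_rw G x Y \<tau>' g' g'' Z"
    and eq: "\<alpha> = rw_class G x X Y \<sigma>" "\<alpha>' = rw_class G x X Y \<sigma>'"
      "\<beta> = rw_class G x Y Z \<tau>" "\<beta>' = rw_class G x Y Z \<tau>'"
    by (elim Surf_SynE)
  show "HComp (Syn G x) X Y Z (VComp (Syn G x) Y Z \<beta>' \<beta>) (VComp (Syn G x) X Y \<alpha>' \<alpha>) =
    VComp (Syn G x) X Z (HComp (Syn G x) X Y Z \<beta>' \<alpha>') (HComp (Syn G x) X Y Z \<beta> \<alpha>)"
    unfolding eq Syn_VComp[OF wt(1,2)] Syn_VComp[OF wt(3,4)]
      Syn_HComp[OF wt_rw.Seq[OF wt(1,2)] wt_rw.Seq[OF wt(3,4)]]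
      Syn_HComp[OF wt(1,3)] Syn_HComp[OF wt(2,4)]
      Syn_VComp[OF wt_rw.RSub[OF wt(3,1)] wt_rw.RSub[OF wt(4,2)]]
    by (rule rw_class_eq[OF eq_rw.interchange[OF wt(3,4,1,2)], symmetric])
next
  fix X Y f assume "f \<in> Edge (Syn G x) X Y"
  then have wt: "wt_trm G x X f Y" by simp
  show "iso_cell (Syn G x) X Y (Comp1 (Syn G x) X Y Y (Id1 (Syn G x) Y) f) f (LUnit (Syn G x) X Y f)"
    using iso_cell_Syn[OF wt_rw.Rho[OF wt] wt_rw.RhoInv[OF wt] eq_rw.RhoInv_Rho[OF wt]
      eq_rw.Rho_RhoInv[OF wt]] by simp
next
  fix X Y f assume "f \<in> Edge (Syn G x) X Y"
  then have wt: "wt_trm G x X f Y" by simp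
  show "iso_cell (Syn G x) X Y (Comp1 (Syn G x) X X Y f (Id1 (Syn G x) X)) f (RUnit (Syn G x) X Y f)"
    using iso_cell_Syn[OF wt_rw.IotaInv[OF wt] wt_rw.Iota[OF wt] eq_rw.Iota_IotaInv[OF wt]
      eq_rw.IotaInv_Iota[OF wt]] by simp
next
  fix W X Y Z f g k
  assume "f \<in> Edge (Syn G x) W X" "g \<in> Edge (Syn G x) X Y" "k \<in> Edge (Syn G x) Y Z"
  then have wt: "wt_trm G x Y k Z" "wt_trm G x X g Y" "wt_trm G x W f X" by simp_all
  show "iso_cell (Syn G x) W Z
       (Comp1 (Syn G x) W X Z (Comp1 (Syn G x) X Y Z k g) f)
       (Comp1 (Syn G x) W Y Z k (Comp1 (Syn G x) W X Y g f))
       (Asc (Syn G x) W X Y Z k g f)"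
    using iso_cell_Syn[OF wt_rw.Assoc[OF wt] wt_rw.AssocInv[OF wt] eq_rw.AssocInv_Assoc[OF wt]
      eq_rw.Assoc_AssocInv[OF wt]] by simp
next
  fix X Y f f' \<alpha>
  assume Y: "Y \<in> Node (Syn G x)" and "\<alpha> \<in> Surf (Syn G x) X Y f f'"
  then obtain \<sigma> where wt: "wt_rw G x X \<sigma> f f' Y" and eq: "\<alpha> = rw_class G x X Y \<sigma>"
    by (elim Surf_SynE)
  have id: "wt_rw G x Y (Ident (Var x)) (Var x) (Var x) Y"
    using Y by (simp add: wt_rw.Ident wt_trm.Var)
  have rho: "wt_rw G x X (Rho f) (Var x\<lbrace>x \<mapsto> f\<rbrace>) f Y" "wt_rw G x X (Rho f') (Var x\<lbrace>x \<mapsto> f'\<rbrace>) f' Y"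
    using wt_rw_trm[OF wt] by (auto intro: wt_rw.Rho)
  show "VComp (Syn G x) X Y (LUnit (Syn G x) X Y f')
      (HComp (Syn G x) X Y Y (Id2 (Syn G x) Y Y (Id1 (Syn G x) Y)) \<alpha>) =
    VComp (Syn G x) X Y \<alpha> (LUnit (Syn G x) X Y f)"
    unfolding eq Syn_simps Syn_HComp[OF wt id] Syn_VComp[OF wt_rw.RSub[OF id wt] rho(2)]
      Syn_VComp[OF rho(1) wt]
    by (rule rw_class_eq[OF eq_rw.Rho_natural[OF wt]])
next
  fix X Y f f' \<alpha>
  assume X: "X \<in> Node (Syn G x)" and "\<alpha> \<in> Surf (Syn G x) X Y f f'"
  then obtain \<tau> where wt: "wt_rw G x X \<tau> f f' Y" and eq: "\<alpha> = rw_class G x X Y \<tau>"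
    by (elim Surf_SynE)
  note trm = wt_rw_trm[OF wt, THEN conjunct1] wt_rw_trm[OF wt, THEN conjunct2]
  have var: "wt_trm G x X (Var x) X" using X by (simp add: wt_trm.Var)
  note id = wt_rw.Ident[OF var]
  let ?C = "rw_class G x X Y"
  note iota = wt_rw.Iota[OF trm(1)] wt_rw.Iota[OF trm(2)]
  note iotaI = wt_rw.IotaInv[OF trm(1)] wt_rw.IotaInv[OF trm(2)]
  note sub = wt_rw.RSub[OF wt id]
  \<comment> \<open>The naturality square of \<open>Iota\<close> is turned around: its two parallel
    sides \<open>Iota f\<close> and \<open>Iota f'\<close> are replaced by their inverses.\<close>
  have "VComp (Syn G x) X Y (?C (IotaInv f')) (?C (\<tau>\<llangle>x \<mapsto> Ident (Var x)\<rrangle>)) =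
    VComp (Syn G x) X Y (?C \<tau>) (?C (IotaInv f))"
  proof (rule hom_category.inverse_square[OF hom_category_Syn,
        where f = f and f' = f' and g' = "f'\<lbrace>x \<mapsto> Var x\<rbrace>"])
    show "VComp (Syn G x) X Y (?C (Iota f)) (?C (IotaInv f)) = Id2 (Syn G x) X Y (f\<lbrace>x \<mapsto> Var x\<rbrace>)"
      unfolding Syn_VComp[OF iotaI(1) iota(1)] Syn_simps
      by (rule rw_class_eq[OF eq_rw.Iota_IotaInv[OF trm(1)]])
    show "VComp (Syn G x) X Y (?C (IotaInv f')) (?C (Iota f')) = Id2 (Syn G x) X Y f'"
      unfolding Syn_VComp[OF iota(2) iotaI(2)] Syn_simps
      by (rule rw_class_eq[OF eq_rw.IotaInv_Iota[OF trm(2)]])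
    show "VComp (Syn G x) X Y (?C (Iota f')) (?C \<tau>) =
      VComp (Syn G x) X Y (?C (\<tau>\<llangle>x \<mapsto> Ident (Var x)\<rrangle>)) (?C (Iota f))"
      unfolding Syn_VComp[OF wt iota(2)] Syn_VComp[OF iota(1) sub]
      by (rule rw_class_eq[OF eq_rw.Iota_natural[OF wt]])
  qed (simp_all add: trm wt_trm.Sub[OF _ var],
       (intro exI conjI, rule HOL.refl, rule iota iotaI sub wt)+)
  then show "VComp (Syn G x) X Y (RUnit (Syn G x) X Y f')
      (HComp (Syn G x) X X Y \<alpha> (Id2 (Syn G x) X X (Id1 (Syn G x) X))) =
    VComp (Syn G x) X Y \<alpha> (RUnit (Syn G x) X Y f)"
    unfolding eq Syn_simps Syn_HComp[OF id wt] .
next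
  fix W X Y Z f f' g g' k k' \<alpha> \<beta> \<gamma>
  assume "\<alpha> \<in> Surf (Syn G x) W X f f'" "\<beta> \<in> Surf (Syn G x) X Y g g'"
    "\<gamma> \<in> Surf (Syn G x) Y Z k k'"
  then obtain \<mu> \<sigma> \<tau> where wt: "wt_rw G x Y \<tau> k k' Z" "wt_rw G x X \<sigma> g g' Y" "wt_rw G x W \<mu> f f' X"
    and eq: "\<alpha> = rw_class G x W X \<mu>" "\<beta> = rw_class G x X Y \<sigma>" "\<gamma> = rw_class G x Y Z \<tau>"
    by (elim Surf_SynE)
  have asc: "wt_rw G x W (Assoc k x g x f) (k\<lbrace>x \<mapsto> g\<rbrace>\<lbrace>x \<mapsto> f\<rbrace>) (k\<lbrace>x \<mapsto> g\<lbrace>x \<mapsto> f\<rbrace>\<rbrace>) Z"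
    "wt_rw G x W (Assoc k' x g' x f') (k'\<lbrace>x \<mapsto> g'\<rbrace>\<lbrace>x \<mapsto> f'\<rbrace>) (k'\<lbrace>x \<mapsto> g'\<lbrace>x \<mapsto> f'\<rbrace>\<rbrace>) Z"
    using wt[THEN wt_rw_trm] by (auto intro: wt_rw.Assoc)
  show "VComp (Syn G x) W Z (Asc (Syn G x) W X Y Z k' g' f')
      (HComp (Syn G x) W X Z (HComp (Syn G x) X Y Z \<gamma> \<beta>) \<alpha>) =
    VComp (Syn G x) W Z (HComp (Syn G x) W Y Z \<gamma> (HComp (Syn G x) W X Y \<beta> \<alpha>))
      (Asc (Syn G x) W X Y Z k g f)"
    unfolding eq Syn_simps Syn_HComp[OF wt(2,1)] Syn_HComp[OF wt(3,2)]
      Syn_HComp[OF wt(3) wt_rw.RSub[OF wt(1,2)]] Syn_HComp[OF wt_rw.RSub[OF wt(2,3)] wt(1)]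
      Syn_VComp[OF wt_rw.RSub[OF wt_rw.RSub[OF wt(1,2)] wt(3)] asc(2)]
      Syn_VComp[OF asc(1) wt_rw.RSub[OF wt(1) wt_rw.RSub[OF wt(2,3)]]]
    by (rule rw_class_eq[OF eq_rw.Assoc_natural[OF wt]])
next
  fix X Y Z f g
  assume Y: "Y \<in> Node (Syn G x)" and "f \<in> Edge (Syn G x) X Y" "g \<in> Edge (Syn G x) Y Z"
  then have wt: "wt_trm G x X f Y" "wt_trm G x Y g Z" "wt_trm G x Y (Var x) Y"
    by (simp_all add: wt_trm.Var)
  let ?C = "rw_class G x X Z" and ?V = "VComp (Syn G x) X Z"
  note id = wt_rw.Ident[OF wt(1)] wt_rw.Ident[OF wt(2)]
  note iota = wt_rw.RSub[OF wt_rw.Iota[OF wt(2)] id(1)]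
  note iotaI = wt_rw.RSub[OF wt_rw.IotaInv[OF wt(2)] id(1)]
  note asc = wt_rw.Assoc[OF wt(2,3,1)]
  note rho = wt_rw.RSub[OF id(2) wt_rw.Rho[OF wt(1)]]
  \<comment> \<open>Both sides are inverse to the whiskered \<open>Iota g\<close>: the left one is a
    left inverse by the triangle equation of the type theory, the right one a right inverse by
    functoriality of substitution.\<close>
  have "?C (Ident g\<llangle>x \<mapsto> Rho f\<rrangle> \<bullet> Assoc g x (Var x) x f) = ?C (IotaInv g\<llangle>x \<mapsto> Ident f\<rrangle>)"
  proof (rule hom_category.inverse_unique[OF hom_category_Syn])
    show "?V (?C (Ident g\<llangle>x \<mapsto> Rho f\<rrangle> \<bullet> Assoc g x (Var x) x f)) (?C (Iota g\<llangle>x \<mapsto> Ident f\<rrangle>)) =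
      Id2 (Syn G x) X Z (g\<lbrace>x \<mapsto> f\<rbrace>)"
      unfolding Syn_VComp[OF iota wt_rw.Seq[OF asc rho]] Syn_simps
      using rw_class_eq[OF eq_rw.Seq_assoc[OF iota asc rho]] rw_class_eq[OF eq_rw.triangle[OF wt(2,1)]]
      by simp
    \<comment> \<open>Whiskering preserves the inverse: interchange merges the two substitutions,
      both arguments then reduce to identities, and \<open>RSub_Ident\<close> finishes.\<close>
    have 1: "eq_rw G x X (Iota g\<llangle>x \<mapsto> Ident f\<rrangle> \<bullet> IotaInv g\<llangle>x \<mapsto> Ident f\<rrangle>)
      ((Iota g \<bullet> IotaInv g)\<llangle>x \<mapsto> Ident f \<bullet> Ident f\<rrangle>) (g\<lbrace>x \<mapsto> Var x\<rbrace>\<lbrace>x \<mapsto> f\<rbrace>) (g\<lbrace>x \<mapsto> Var x\<rbrace>\<lbrace>x \<mapsto> f\<rbrace>) Z"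
      by (rule eq_rw.interchange[OF wt_rw.IotaInv[OF wt(2)] wt_rw.Iota[OF wt(2)] id(1) id(1)])
    have 2: "eq_rw G x X ((Iota g \<bullet> IotaInv g)\<llangle>x \<mapsto> Ident f \<bullet> Ident f\<rrangle>)
      (Ident (g\<lbrace>x \<mapsto> Var x\<rbrace>)\<llangle>x \<mapsto> Ident f\<rrangle>) (g\<lbrace>x \<mapsto> Var x\<rbrace>\<lbrace>x \<mapsto> f\<rbrace>) (g\<lbrace>x \<mapsto> Var x\<rbrace>\<lbrace>x \<mapsto> f\<rbrace>) Z"
      by (rule eq_rw.RSub[OF eq_rw.Iota_IotaInv[OF wt(2)] eq_rw.Ident_left[OF id(1)]])
    have 3: "eq_rw G x X (Ident (g\<lbrace>x \<mapsto> Var x\<rbrace>)\<llangle>x \<mapsto> Ident f\<rrangle>) (Ident (g\<lbrace>x \<mapsto> Var x\<rbrace>\<lbrace>x \<mapsto> f\<rbrace>))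
      (g\<lbrace>x \<mapsto> Var x\<rbrace>\<lbrace>x \<mapsto> f\<rbrace>) (g\<lbrace>x \<mapsto> Var x\<rbrace>\<lbrace>x \<mapsto> f\<rbrace>) Z"
      by (rule eq_rw.RSub_Ident[OF wt_trm.Sub[OF wt(2,3)] wt(1)])
    show "?V (?C (Iota g\<llangle>x \<mapsto> Ident f\<rrangle>)) (?C (IotaInv g\<llangle>x \<mapsto> Ident f\<rrangle>)) =
      Id2 (Syn G x) X Z (g\<lbrace>x \<mapsto> Var x\<rbrace>\<lbrace>x \<mapsto> f\<rbrace>)"
      unfolding Syn_VComp[OF iotaI iota] Syn_simps
      by (rule rw_class_eq[OF eq_rw.trans[OF 1 eq_rw.trans[OF 2 3]]])
  qed (simp_all add: wt_trm.Sub[OF wt(2,1)] wt_trm.Sub[OF wt_trm.Sub[OF wt(2,3)] wt(1)],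
       (intro exI conjI, rule HOL.refl, rule iota iotaI wt_rw.Seq[OF asc rho])+)
  then show "VComp (Syn G x) X Z
      (HComp (Syn G x) X Y Z (Id2 (Syn G x) Y Z g) (LUnit (Syn G x) X Y f))
      (Asc (Syn G x) X Y Y Z g (Id1 (Syn G x) Y) f) =
    HComp (Syn G x) X Y Z (RUnit (Syn G x) Y Z g) (Id2 (Syn G x) X Y f)"
    unfolding Syn_simps Syn_HComp[OF wt_rw.Rho[OF wt(1)] id(2)]
      Syn_HComp[OF id(1) wt_rw.IotaInv[OF wt(2)]] Syn_VComp[OF asc rho] .
next
  fix V W X Y Z f g k l
  assume "f \<in> Edge (Syn G x) V W" "g \<in> Edge (Syn G x) W X" "k \<in> Edge (Syn G x) X Y"
    "l \<in> Edge (Syn G x) Y Z"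
  then have wt: "wt_trm G x Y l Z" "wt_trm G x X k Y" "wt_trm G x W g X" "wt_trm G x V f W"
    by simp_all
  note id = wt_rw.Ident[OF wt(1)] wt_rw.Ident[OF wt(4)]
  note asc = wt_rw.Assoc[OF wt(2-4)] wt_rw.Assoc[OF wt(1) wt_trm.Sub[OF wt(2,3)] wt(4)]
    wt_rw.Assoc[OF wt(1-3)] wt_rw.Assoc[OF wt(1,2) wt_trm.Sub[OF wt(3,4)]]
    wt_rw.Assoc[OF wt_trm.Sub[OF wt(1,2)] wt(3,4)]
  note sub = wt_rw.RSub[OF id(1) asc(1)] wt_rw.RSub[OF asc(3) id(2)]
  show "VComp (Syn G x) V Z
      (HComp (Syn G x) V Y Z (Id2 (Syn G x) Y Z l) (Asc (Syn G x) V W X Y k g f))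
      (VComp (Syn G x) V Z (Asc (Syn G x) V W Y Z l (Comp1 (Syn G x) W X Y k g) f)
        (HComp (Syn G x) V W Z (Asc (Syn G x) W X Y Z l k g) (Id2 (Syn G x) V W f))) =
    VComp (Syn G x) V Z (Asc (Syn G x) V X Y Z l k (Comp1 (Syn G x) V W X g f))
      (Asc (Syn G x) V W X Z (Comp1 (Syn G x) X Y Z l k) g f)"
    unfolding Syn_simps Syn_HComp[OF asc(1) id(1)] Syn_HComp[OF id(2) asc(3)]
      Syn_VComp[OF sub(2) asc(2)] Syn_VComp[OF wt_rw.Seq[OF sub(2) asc(2)] sub(1)]
      Syn_VComp[OF asc(5,4)]
    by (rule rw_class_eq[OF eq_rw.pentagon[OF wt]])
qed


section \<open>Interpretation in a bicategory\<close>

text \<open>A bicategory here only asserts that inverses exist, so one is chosen. The boundary is an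
  argument because the operations of \<open>B\<close> do not recover it from the bare element
  \<open>\<alpha>\<close>.\<close>

definition inv_cell ::
  "('o, 'a, 'c, 'x) bicat_scheme \<Rightarrow> 'o \<Rightarrow> 'o \<Rightarrow> 'a \<Rightarrow> 'a \<Rightarrow> 'c \<Rightarrow> 'c" where
  "inv_cell B X Y f g \<alpha> = (SOME \<beta>. \<beta> \<in> Surf B X Y g f \<and>
     VComp B X Y \<beta> \<alpha> = Id2 B X Y f \<and> VComp B X Y \<alpha> \<beta> = Id2 B X Y g)"

lemma inv_cell:
  assumes "iso_cell B X Y f g \<alpha>"
  shows "inv_cell B X Y f g \<alpha> \<in> Surf B X Y g f"
    and "VComp B X Y (inv_cell B X Y f g \<alpha>) \<alpha> = Id2 B X Y f"
    and "VComp B X Y \<alpha> (inv_cell B X Y f g \<alpha>) = Id2 B X Y g"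
proof -
  have "\<exists>\<beta>. \<beta> \<in> Surf B X Y g f \<and>
     VComp B X Y \<beta> \<alpha> = Id2 B X Y f \<and> VComp B X Y \<alpha> \<beta> = Id2 B X Y g"
    using assms unfolding iso_cell_def by blast
  from someI_ex[OF this, folded inv_cell_def]
  show "inv_cell B X Y f g \<alpha> \<in> Surf B X Y g f"
    and "VComp B X Y (inv_cell B X Y f g \<alpha>) \<alpha> = Id2 B X Y f"
    and "VComp B X Y \<alpha> (inv_cell B X Y f g \<alpha>) = Id2 B X Y g"
    by simp_all
qed

lemma iso_cell_Surf: "iso_cell B X Y f g \<alpha> \<Longrightarrow> \<alpha> \<in> Surf B X Y f g"
  by (simp add: iso_cell_def)

text \<open>Variables and substitutions carry no types, so the type of a term is recovered from the
  type \<open>A\<close> of its context: a constant supplies its own codomain, and a body is read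
  over the type of the substituted term. Being total, the recursion also gives values on underivable
  terms, about which nothing is claimed.\<close>

primrec raw_ty :: "'n \<Rightarrow> ('n, 'e, 'v) raw_trm \<Rightarrow> 'n" where
  "raw_ty A (rVar x) = A"
| "raw_ty A (rCst A' B c x) = B"
| "raw_ty A (rSub t x u) = raw_ty (raw_ty A u) t"

text \<open>For a composite, the type is read from the rewrite performed first; in a derivable
  composite both factors have the same type.\<close>

primrec raw_rw_ty :: "'n \<Rightarrow> ('n, 'e, 's, 'v) raw_rw \<Rightarrow> 'n" where
  "raw_rw_ty A (rIdent t) = raw_ty A t"
| "raw_rw_ty A (rSurface A' B c c' \<sigma> x) = B"
| "raw_rw_ty A (rIota t) = raw_ty A t"
| "raw_rw_ty A (rRho u) = raw_ty A u"
| "raw_rw_ty A (rAssoc t y v x u) = raw_ty (raw_ty (raw_ty A u) v) t"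
| "raw_rw_ty A (rIotaInv t) = raw_ty A t"
| "raw_rw_ty A (rRhoInv u) = raw_ty A u"
| "raw_rw_ty A (rAssocInv t y v x u) = raw_ty (raw_ty (raw_ty A u) v) t"
| "raw_rw_ty A (rSeq \<tau>' \<tau>) = raw_rw_ty A \<tau>"
| "raw_rw_ty A (rRSub \<tau> x \<sigma>) = raw_rw_ty (raw_rw_ty A \<sigma>) \<tau>"

primrec raw_edge ::
  "('o, 'a, 'c) bicat \<Rightarrow> ('n, 'e, 's, 'o, 'a, 'c) hom \<Rightarrow> 'n \<Rightarrow> ('n, 'e, 'v) raw_trm \<Rightarrow> 'a" where
  "raw_edge B h A (rVar x) = Id1 B (on_node h A)"
| "raw_edge B h A (rCst A' C c x) = on_edge h A' C c"
| "raw_edge B h A (rSub t x u) =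
    Comp1 B (on_node h A) (on_node h (raw_ty A u)) (on_node h (raw_ty (raw_ty A u) t))
      (raw_edge B h (raw_ty A u) t) (raw_edge B h A u)"

abbreviation inv_lunit :: "('o, 'a, 'c) bicat \<Rightarrow> 'o \<Rightarrow> 'o \<Rightarrow> 'a \<Rightarrow> 'c" where
  "inv_lunit B X Y f \<equiv> inv_cell B X Y (Comp1 B X Y Y (Id1 B Y) f) f (LUnit B X Y f)"

abbreviation inv_runit :: "('o, 'a, 'c) bicat \<Rightarrow> 'o \<Rightarrow> 'o \<Rightarrow> 'a \<Rightarrow> 'c" where
  "inv_runit B X Y f \<equiv> inv_cell B X Y (Comp1 B X X Y f (Id1 B X)) f (RUnit B X Y f)"

abbreviation inv_asc ::
  "('o, 'a, 'c) bicat \<Rightarrow> 'o \<Rightarrow> 'o \<Rightarrow> 'o \<Rightarrow> 'o \<Rightarrow> 'a \<Rightarrow> 'a \<Rightarrow> 'a \<Rightarrow> 'c" where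
  "inv_asc B W X Y Z k g f \<equiv> inv_cell B W Z
     (Comp1 B W X Z (Comp1 B X Y Z k g) f) (Comp1 B W Y Z k (Comp1 B W X Y g f))
     (Asc B W X Y Z k g f)"

text \<open>\<open>rIotaInv\<close> is the formal right unitor, so it receives \<open>RUnit\<close>
  and \<open>rIota\<close> receives the chosen inverse. For the left unitor and the associator the
  inverse falls on the formal inverse instead.\<close>

primrec raw_cell ::
  "('o, 'a, 'c) bicat \<Rightarrow> ('n, 'e, 's, 'o, 'a, 'c) hom \<Rightarrow> 'n \<Rightarrow> ('n, 'e, 's, 'v) raw_rw \<Rightarrow> 'c"
  where
  "raw_cell B h A (rIdent t) =
    Id2 B (on_node h A) (on_node h (raw_ty A t)) (raw_edge B h A t)"
| "raw_cell B h A (rSurface A' C c c' \<sigma> x) = on_surf h A' C c c' \<sigma>"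
| "raw_cell B h A (rIota t) = inv_runit B (on_node h A) (on_node h (raw_ty A t)) (raw_edge B h A t)"
| "raw_cell B h A (rRho u) = LUnit B (on_node h A) (on_node h (raw_ty A u)) (raw_edge B h A u)"
| "raw_cell B h A (rAssoc t y v x u) =
    Asc B (on_node h A) (on_node h (raw_ty A u)) (on_node h (raw_ty (raw_ty A u) v))
      (on_node h (raw_ty (raw_ty (raw_ty A u) v) t))
      (raw_edge B h (raw_ty (raw_ty A u) v) t) (raw_edge B h (raw_ty A u) v) (raw_edge B h A u)"
| "raw_cell B h A (rIotaInv t) = RUnit B (on_node h A) (on_node h (raw_ty A t)) (raw_edge B h A t)"
| "raw_cell B h A (rRhoInv u) = inv_lunit B (on_node h A) (on_node h (raw_ty A u)) (raw_edge B h A u)"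
| "raw_cell B h A (rAssocInv t y v x u) =
    inv_asc B (on_node h A) (on_node h (raw_ty A u)) (on_node h (raw_ty (raw_ty A u) v))
      (on_node h (raw_ty (raw_ty (raw_ty A u) v) t))
      (raw_edge B h (raw_ty (raw_ty A u) v) t) (raw_edge B h (raw_ty A u) v) (raw_edge B h A u)"
| "raw_cell B h A (rSeq \<tau>' \<tau>) =
    VComp B (on_node h A) (on_node h (raw_rw_ty A \<tau>)) (raw_cell B h A \<tau>') (raw_cell B h A \<tau>)"
| "raw_cell B h A (rRSub \<tau> x \<sigma>) =
    HComp B (on_node h A) (on_node h (raw_rw_ty A \<sigma>)) (on_node h (raw_rw_ty (raw_rw_ty A \<sigma>) \<tau>))
      (raw_cell B h (raw_rw_ty A \<sigma>) \<tau>) (raw_cell B h A \<sigma>)"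

lemma raw_ty_rename: "raw_ty A (rename_trm f t) = raw_ty A t"
  by (induction t arbitrary: A) simp_all

lemma raw_rw_ty_rename: "raw_rw_ty A (rename_rw f \<tau>) = raw_rw_ty A \<tau>"
  by (induction \<tau> arbitrary: A) (simp_all add: raw_ty_rename)

lemma raw_edge_rename: "raw_edge B h A (rename_trm f t) = raw_edge B h A t"
  by (induction t arbitrary: A) (simp_all add: raw_ty_rename)

lemma raw_cell_rename: "raw_cell B h A (rename_rw f \<tau>) = raw_cell B h A \<tau>"
  by (induction \<tau> arbitrary: A) (simp_all add: raw_ty_rename raw_rw_ty_rename raw_edge_rename)

lift_definition ty :: "'n \<Rightarrow> ('n, 'e) trm \<Rightarrow> 'n" is raw_ty
  by (metis alpha_trm_invariant raw_ty_rename)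

lift_definition rw_ty :: "'n \<Rightarrow> ('n, 'e, 's) rw \<Rightarrow> 'n" is raw_rw_ty
  by (metis alpha_rw_invariant raw_rw_ty_rename)

lift_definition edge ::
  "('o, 'a, 'c) bicat \<Rightarrow> ('n, 'e, 's, 'o, 'a, 'c) hom \<Rightarrow> 'n \<Rightarrow> ('n, 'e) trm \<Rightarrow> 'a" is raw_edge
  by (metis alpha_trm_invariant raw_edge_rename)

lift_definition cell ::
  "('o, 'a, 'c) bicat \<Rightarrow> ('n, 'e, 's, 'o, 'a, 'c) hom \<Rightarrow> 'n \<Rightarrow> ('n, 'e, 's) rw \<Rightarrow> 'c" is raw_cell
  by (metis alpha_rw_invariant raw_cell_rename)

lemma ty_simps [simp]:
  "ty A (Var x) = A"
  "ty A (Cst A' C c x) = C"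
  "ty A (t\<lbrace>x \<mapsto> u\<rbrace>) = ty (ty A u) t"
  by (transfer; simp)+

lemma rw_ty_simps [simp]:
  "rw_ty A (Ident t) = ty A t"
  "rw_ty A (Surface A' C c c' \<sigma> x) = C"
  "rw_ty A (Iota t) = ty A t"
  "rw_ty A (Rho u) = ty A u"
  "rw_ty A (Assoc t y v x u) = ty (ty (ty A u) v) t"
  "rw_ty A (IotaInv t) = ty A t"
  "rw_ty A (RhoInv u) = ty A u"
  "rw_ty A (AssocInv t y v x u) = ty (ty (ty A u) v) t"
  "rw_ty A (\<tau>' \<bullet> \<tau>) = rw_ty A \<tau>"
  "rw_ty A (\<tau>\<llangle>x \<mapsto> \<mu>\<rrangle>) = rw_ty (rw_ty A \<mu>) \<tau>"
  by (transfer; simp)+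

lemma edge_simps [simp]:
  "edge B h A (Var x) = Id1 B (on_node h A)"
  "edge B h A (Cst A' C c x) = on_edge h A' C c"
  "edge B h A (t\<lbrace>x \<mapsto> u\<rbrace>) =
    Comp1 B (on_node h A) (on_node h (ty A u)) (on_node h (ty (ty A u) t))
      (edge B h (ty A u) t) (edge B h A u)"
  by (transfer; simp)+

lemma cell_simps [simp]:
  "cell B h A (Ident t) = Id2 B (on_node h A) (on_node h (ty A t)) (edge B h A t)"
  "cell B h A (Surface A' C c c' \<sigma> x) = on_surf h A' C c c' \<sigma>"
  "cell B h A (Iota t) = inv_runit B (on_node h A) (on_node h (ty A t)) (edge B h A t)"
  "cell B h A (Rho u) = LUnit B (on_node h A) (on_node h (ty A u)) (edge B h A u)"
  "cell B h A (Assoc t y v x u) =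
    Asc B (on_node h A) (on_node h (ty A u)) (on_node h (ty (ty A u) v))
      (on_node h (ty (ty (ty A u) v) t))
      (edge B h (ty (ty A u) v) t) (edge B h (ty A u) v) (edge B h A u)"
  "cell B h A (IotaInv t) = RUnit B (on_node h A) (on_node h (ty A t)) (edge B h A t)"
  "cell B h A (RhoInv u) = inv_lunit B (on_node h A) (on_node h (ty A u)) (edge B h A u)"
  "cell B h A (AssocInv t y v x u) =
    inv_asc B (on_node h A) (on_node h (ty A u)) (on_node h (ty (ty A u) v))
      (on_node h (ty (ty (ty A u) v) t))
      (edge B h (ty (ty A u) v) t) (edge B h (ty A u) v) (edge B h A u)"
  "cell B h A (\<tau>' \<bullet> \<tau>) =
    VComp B (on_node h A) (on_node h (rw_ty A \<tau>)) (cell B h A \<tau>') (cell B h A \<tau>)"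
  "cell B h A (\<tau>\<llangle>x \<mapsto> \<mu>\<rrangle>) =
    HComp B (on_node h A) (on_node h (rw_ty A \<mu>)) (on_node h (rw_ty (rw_ty A \<mu>) \<tau>))
      (cell B h (rw_ty A \<mu>) \<tau>) (cell B h A \<mu>)"
  by (transfer; simp)+

lemma edge_collapse [simp]: "edge B h A (collapse_trm x t) = edge B h A t"
  by transfer (rule raw_edge_rename)

lemma (in bicategory) hom_category_cells:
  assumes "X \<in> Node B" "Y \<in> Node B"
  shows "hom_category (Edge B X Y) (Surf B X Y) (Id2 B X Y) (VComp B X Y)"
  using assms by unfold_locales
    (auto intro: Id2_cell VComp_cell VComp_assoc VComp_Id2_left VComp_Id2_right)

section \<open>Typing and soundness of the interpretation\<close>

locale two_graph_model = bicategory B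
  for B :: "('o, 'a, 'c) bicat" +
  fixes G :: "('n, 'e, 's) two_graph" and h :: "('n, 'e, 's, 'o, 'a, 'c) hom"
  assumes hom: "two_graph_hom G B h"
begin

abbreviation "N \<equiv> on_node h"
abbreviation "E \<equiv> edge B h"
abbreviation "S \<equiv> cell B h"

lemma N_Node: "A \<in> Node G \<Longrightarrow> N A \<in> Node B"
  using hom by (simp add: two_graph_hom_def)

text \<open>The type and the 1-cell are treated together: in the case of a substitution, the
  computed type of \<open>u\<close> must be the middle object before the two 1-cells can be
  composed.\<close>

lemma trm_typing:
  "wt_trm G x A t C \<Longrightarrow>
   N A \<in> Node B \<and> N C \<in> Node B \<and> ty A t = C \<and> E A t \<in> Edge B (N A) (N C)"
proof (induction rule: wt_trm.induct)
  case (Var A x)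
  then show ?case by (simp add: N_Node Id1_edge)
next
  case (Cst A C c x)
  then show ?case using hom by (simp add: two_graph_hom_def)
next
  case (Sub x A t C y D u)
  then show ?case by (auto intro: Comp1_edge)
qed

lemma rw_typing:
  "wt_rw G x A \<tau> t t' C \<Longrightarrow>
   rw_ty A \<tau> = C \<and> S A \<tau> \<in> Surf B (N A) (N C) (E A t) (E A t')"
proof (induction rule: wt_rw.induct)
  case (Ident x A t C)
  then show ?case using trm_typing[OF Ident] by (simp add: Id2_cell)
next
  case (Surface A C c c' \<sigma> x)
  then show ?case using hom by (simp add: two_graph_hom_def)
next
  case (Iota x A t C)
  then show ?case using trm_typing[OF Iota] by (simp add: inv_cell(1) RUnit_iso)
next
  case (Rho y D u A x)
  then show ?case using trm_typing[OF Rho] by (simp add: iso_cell_Surf LUnit_iso)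
next
  case (Assoc y C t T x A v z D u)
  then show ?case using Assoc[THEN trm_typing] by (simp add: iso_cell_Surf Asc_iso)
next
  case (IotaInv x A t C)
  then show ?case using trm_typing[OF IotaInv] by (simp add: iso_cell_Surf RUnit_iso)
next
  case (RhoInv y D u A x)
  then show ?case using trm_typing[OF RhoInv] by (simp add: inv_cell(1) LUnit_iso)
next
  case (AssocInv y C t T x A v z D u)
  then show ?case using AssocInv[THEN trm_typing] by (simp add: inv_cell(1) Asc_iso)
next
  case (Seq x A \<tau> t t' C \<tau>' t'')
  then show ?case
    using Seq.hyps[THEN wt_rw_trm] VComp_cell[of "N A" "N C" "E A t" "E A t'" "E A t''"]
    by (auto dest: trm_typing)
next
  case (RSub x A \<tau> t t' C y D \<sigma> u u')
  have "wt_trm G x A t C" "wt_trm G x A t' C" "wt_trm G y D u A" "wt_trm G y D u' A"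
    using RSub.hyps[THEN wt_rw_trm] by auto
  note this[THEN trm_typing]
  then show ?case using RSub.IH
      HComp_cell[of "N D" "N A" "N C" "E D u" "E D u'" "E A t" "E A t'" "S D \<sigma>" "S A \<tau>"]
    by simp
qed

lemma rw_facts:
  assumes "wt_rw G x A \<tau> t t' C"
  shows "N A \<in> Node B" "N C \<in> Node B" "ty A t = C" "ty A t' = C"
    "E A t \<in> Edge B (N A) (N C)" "E A t' \<in> Edge B (N A) (N C)"
    "rw_ty A \<tau> = C" "S A \<tau> \<in> Surf B (N A) (N C) (E A t) (E A t')"
  using wt_rw_trm[OF assms] rw_typing[OF assms] trm_typing by blast+

text \<open>Each equation becomes a law of \<open>B\<close> between cells whose boundaries are known
  from typing. The naturality of \<open>Iota\<close> and the triangle equation need an argument,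
  because \<open>Iota\<close> is interpreted by an inverse right unitor.\<close>

lemma soundness: "eq_rw G x A \<tau> \<tau>' t t' C \<Longrightarrow> S A \<tau> = S A \<tau>'"
proof (induction rule: eq_rw.induct)
  case (Seq x A \<tau>1 \<tau>2 t t' C \<tau>1' \<tau>2' t'')
  \<comment> \<open>The interpretation of a composite uses the type of its first factor as an index,
    so the types of the two sides must be matched as well as their cells.\<close>
  have "rw_ty A \<tau>1 = rw_ty A \<tau>2" using eq_rw_wt[OF Seq.hyps(1)] rw_facts(7) by metis
  with Seq.IH show ?case by simp
next
  case (RSub x A \<tau>1 \<tau>2 t t' C y D \<sigma>1 \<sigma>2 u u')
  have "rw_ty A \<tau>1 = C" "rw_ty A \<tau>2 = C" "rw_ty D \<sigma>1 = A" "rw_ty D \<sigma>2 = A"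
    using eq_rw_wt[OF RSub.hyps(1)] eq_rw_wt[OF RSub.hyps(2)] rw_facts(7) by blast+
  with RSub.IH show ?case by simp
next
  case (Seq_assoc x A \<tau> t t' C \<tau>' t'' \<tau>'' t''')
  then show ?case
    using VComp_assoc[of "N A" "N C" "E A t" "E A t'" "E A t''" "E A t'''" "S A \<tau>" "S A \<tau>'" "S A \<tau>''"]
    by (simp add: rw_facts)
next
  case (Ident_left x A \<tau> t t' C)
  then show ?case
    using VComp_Id2_left[of "N A" "N C" "E A t" "E A t'" "S A \<tau>"] by (simp add: rw_facts)
next
  case (Ident_right x A \<tau> t t' C)
  then show ?case
    using VComp_Id2_right[of "N A" "N C" "E A t" "E A t'" "S A \<tau>"] by (simp add: rw_facts)
next
  case (RSub_Ident x A t C y D u)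
  then show ?case using RSub_Ident[THEN trm_typing] by (simp add: HComp_Id2)
next
  case (interchange x A \<tau> t t' C \<tau>' t'' y D \<sigma> u u' \<sigma>' u'')
  note f = interchange[THEN rw_facts(1)] interchange[THEN rw_facts(2)]
    interchange[THEN rw_facts(5)] interchange[THEN rw_facts(6)]
    interchange[THEN rw_facts(7)] interchange[THEN rw_facts(8)]
  show ?case
    using f bicategory.interchange[OF bicategory_axioms, of "N D" "N A" "N C"
      "E D u" "E D u'" "E D u''" "E A t" "E A t'" "E A t''" "S D \<sigma>" "S D \<sigma>'" "S A \<tau>" "S A \<tau>'"]
    by simp
next
  case (Rho_natural y D \<sigma> u u' A x)
  note f = rw_facts[OF Rho_natural]
  show ?case using f LUnit_natural[of "N D" "N A" "E D u" "E D u'" "S D \<sigma>"] by simp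
next
  case (Iota_natural x A \<tau> t t' C)
  note f = rw_facts[OF Iota_natural]
  let ?r = "RUnit B (N A) (N C)" and ?e = "\<lambda>f. Comp1 B (N A) (N A) (N C) f (Id1 B (N A))"
  note iso = RUnit_iso[OF f(1,2,5)] RUnit_iso[OF f(1,2,6)]
  have id: "Id1 B (N A) \<in> Edge B (N A) (N A)" using f(1) by (rule Id1_edge)
  \<comment> \<open>\<open>RUnit_natural\<close> is the square for the right unitor; reversing its
    two unitor sides gives the square required of \<open>Iota\<close>.\<close>
  have "VComp B (N A) (N C) (inv_cell B (N A) (N C) (?e (E A t')) (E A t') (?r (E A t'))) (S A \<tau>) =
    VComp B (N A) (N C) (HComp B (N A) (N A) (N C) (S A \<tau>) (Id2 B (N A) (N A) (Id1 B (N A))))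
     (inv_cell B (N A) (N C) (?e (E A t)) (E A t) (?r (E A t)))"
    by (rule hom_category.inverse_square[OF hom_category_cells[OF f(1,2)], OF _ _ f(5,6)
        iso_cell_Surf[OF iso(1)] inv_cell(1,3)[OF iso(1)]
        iso_cell_Surf[OF iso(2)] inv_cell(1,2)[OF iso(2)] _ f(8)])
      (use f id in \<open>auto intro: Comp1_edge HComp_cell Id2_cell RUnit_natural\<close>)
  then show ?case using f by simp
next
  case (Assoc_natural y C \<tau> t t' T x A \<sigma> v v' z D \<mu> u u')
  note f = Assoc_natural[THEN rw_facts(1)] Assoc_natural[THEN rw_facts(2)]
    Assoc_natural[THEN rw_facts(3)] Assoc_natural[THEN rw_facts(4)]
    Assoc_natural[THEN rw_facts(5)] Assoc_natural[THEN rw_facts(6)]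
    Assoc_natural[THEN rw_facts(7)] Assoc_natural[THEN rw_facts(8)]
  show ?case
    using f Asc_natural[of "N D" "N A" "N C" "N T" "E D u" "E D u'" "E A v" "E A v'" "E C t" "E C t'"
      "S D \<mu>" "S A \<sigma>" "S C \<tau>"] by simp
next
  case (triangle x A t C y D u)
  then have f: "N A \<in> Node B" "N C \<in> Node B" "N D \<in> Node B" "ty A t = C" "ty D u = A"
    "E A t \<in> Edge B (N A) (N C)" "E D u \<in> Edge B (N D) (N A)"
    by (auto dest: trm_typing)
  let ?f = "E D u" and ?g = "E A t" and ?I = "Id1 B (N A)"
  let ?V = "VComp B (N D) (N C)" and ?H = "HComp B (N D) (N A) (N C)"
  let ?gI = "Comp1 B (N A) (N A) (N C) ?g ?I"
  let ?r = "RUnit B (N A) (N C) ?g" and ?i = "Id2 B (N D) (N A) ?f"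
  let ?r' = "inv_cell B (N A) (N C) ?gI ?g ?r"
  let ?l = "?H (Id2 B (N A) (N C) ?g) (LUnit B (N D) (N A) ?f)"
  let ?a = "Asc B (N D) (N A) (N A) (N C) ?g ?I ?f"
  note iso = RUnit_iso[OF f(1,2,6)]
  have I: "?I \<in> Edge B (N A) (N A)" using f(1) by (rule Id1_edge)
  have i: "?i \<in> Surf B (N D) (N A) ?f ?f" using f by (simp add: Id2_cell)
  have gI: "?gI \<in> Edge B (N A) (N C)" using f I by (simp add: Comp1_edge)
  have a: "?a \<in> Surf B (N D) (N C) (Comp1 B (N D) (N A) (N C) ?gI ?f)
      (Comp1 B (N D) (N A) (N C) ?g (Comp1 B (N D) (N A) (N A) ?I ?f))"
    using f I by (simp add: iso_cell_Surf Asc_iso)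
  have l: "?l \<in> Surf B (N D) (N C) (Comp1 B (N D) (N A) (N C) ?g (Comp1 B (N D) (N A) (N A) ?I ?f))
      (Comp1 B (N D) (N A) (N C) ?g ?f)"
    using f I by (intro HComp_cell) (simp_all add: Comp1_edge Id2_cell iso_cell_Surf LUnit_iso)
  have r': "?H ?r' ?i \<in> Surf B (N D) (N C) (Comp1 B (N D) (N A) (N C) ?g ?f)
      (Comp1 B (N D) (N A) (N C) ?gI ?f)"
    using f gI i inv_cell(1)[OF iso] by (intro HComp_cell) simp_all
  \<comment> \<open>After reassociation, the triangle law of \<open>B\<close> replaces
    \<open>?l\<close> after \<open>?a\<close> by the whiskered right unitor. By interchange this
    cancels against the whiskering of its inverse \<open>?r'\<close>.\<close>
  have "?V ?l (?V ?a (?H ?r' ?i)) = ?V (?V ?l ?a) (?H ?r' ?i)"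
    using f I gI by (intro VComp_assoc[OF _ _ _ _ _ _ r' a l, symmetric]) (simp_all add: Comp1_edge)
  also have "?V ?l ?a = ?H ?r ?i" using f by (intro bicategory.triangle[OF bicategory_axioms])
  also have "?V (?H ?r ?i) (?H ?r' ?i) = ?H (VComp B (N A) (N C) ?r ?r') (VComp B (N D) (N A) ?i ?i)"
    using f gI by (intro bicategory.interchange[OF bicategory_axioms _ _ _ _ _ _ _ _ _ i i
      inv_cell(1)[OF iso] iso_cell_Surf[OF iso], symmetric])
  also have "\<dots> = Id2 B (N D) (N C) (Comp1 B (N D) (N A) (N C) ?g ?f)"
    using f i by (simp add: inv_cell(3)[OF iso] VComp_Id2_left[OF _ _ _ _ i] HComp_Id2)
  finally show ?case using f by simp
next
  case (pentagon z C t D y C' w x A v r T u)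
  then have "N A \<in> Node B" "N C \<in> Node B" "N C' \<in> Node B" "N D \<in> Node B" "N T \<in> Node B"
    "ty C t = D" "ty C' w = C" "ty A v = C'" "ty T u = A"
    "E C t \<in> Edge B (N C) (N D)" "E C' w \<in> Edge B (N C') (N C)"
    "E A v \<in> Edge B (N A) (N C')" "E T u \<in> Edge B (N T) (N A)"
    by (auto dest: trm_typing)
  then show ?case
    by (simp add: bicategory.pentagon[OF bicategory_axioms])
next
  case (Iota_IotaInv x A t C)
  then show ?case using trm_typing[OF Iota_IotaInv] by (simp add: inv_cell(2) RUnit_iso)
next
  case (IotaInv_Iota x A t C)
  then show ?case using trm_typing[OF IotaInv_Iota] by (simp add: inv_cell(3) RUnit_iso)
next
  case (Rho_RhoInv y D u A)
  then show ?case using trm_typing[OF Rho_RhoInv] by (simp add: inv_cell(3) LUnit_iso)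
next
  case (RhoInv_Rho y D u A x)
  then show ?case using trm_typing[OF RhoInv_Rho] by (simp add: inv_cell(2) LUnit_iso)
next
  case (Assoc_AssocInv y C t T x A v z D u)
  then show ?case using Assoc_AssocInv[THEN trm_typing] by (simp add: inv_cell(3) Asc_iso)
next
  case (AssocInv_Assoc y C t T x A v z D u)
  then show ?case using AssocInv_Assoc[THEN trm_typing] by (simp add: inv_cell(2) Asc_iso)
qed simp_all

section \<open>Existence of the strict extension\<close>

definition extension :: "('n, ('n, 'e) trm, ('n, 'e, 's) rw set, 'o, 'a, 'c) psfun" where
  "extension =
    \<lparr>on_node = N,
     on_edge = \<lambda>A C t. E A t,
     on_surf = \<lambda>A C t t' \<alpha>. S A (SOME \<tau>. \<tau> \<in> \<alpha>),
     unit_cell = \<lambda>A. Id2 B (N A) (N A) (Id1 B (N A)),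
     comp_cell = \<lambda>A C D g f. Id2 B (N A) (N D) (Comp1 B (N A) (N C) (N D) (E C g) (E A f))\<rparr>"

lemma extension_simps [simp]:
  "on_node extension = N"
  "on_edge extension A C t = E A t"
  "unit_cell extension A = Id2 B (N A) (N A) (Id1 B (N A))"
  "comp_cell extension A C D t u = Id2 B (N A) (N D) (Comp1 B (N A) (N C) (N D) (E C t) (E A u))"
  by (simp_all add: extension_def)

text \<open>The extension evaluates a class at a chosen representative. Every member is equal to
  \<open>\<tau>\<close> in the type theory, so soundness makes the choice immaterial.\<close>

lemma extension_on_surf [simp]:
  assumes "wt_rw G x A \<tau> t t' C"
  shows "on_surf extension A C s s' (rw_class G x A C \<tau>) = S A \<tau>"
proof -
  have "(SOME \<tau>'. \<tau>' \<in> rw_class G x A C \<tau>) \<in> rw_class G x A C \<tau>"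
    using rw_class_refl[OF assms] by (rule someI)
  from soundness[OF rw_class_mem[OF assms this]] show ?thesis by (simp add: extension_def)
qed

text \<open>Preservation of compositions is built into the recursion defining \<open>cell\<close>.
  The structural cells are identities, so naturality of \<open>comp_cell\<close> reduces to
  preservation of horizontal composition, and each coherence law to preservation of a unitor or the
  associator, which holds by the clauses for \<open>IotaInv\<close>, \<open>Rho\<close> and
  \<open>Assoc\<close>.\<close>

lemma strict_pseudofunctor_extension: "strict_pseudofunctor (Syn G x) B extension"
proof -
  interpret Syn: bicategory "Syn G x" by (rule bicategory_Syn)
  let ?F = "extension"
  show ?thesis
  proof unfold_locales
    show "two_graph_hom (Syn G x) B ?F"
      unfolding two_graph_hom_def
      by (auto simp: N_Node dest: trm_typing rw_typing)
  next
    fix X Y f assume "f \<in> Edge (Syn G x) X Y"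
    then have wt: "wt_trm G x X f Y" by simp
    then show "on_surf ?F X Y f f (Id2 (Syn G x) X Y f) =
      Id2 B (on_node ?F X) (on_node ?F Y) (on_edge ?F X Y f)"
      using trm_typing[OF wt] by (simp add: extension_on_surf[OF wt_rw.Ident[OF wt]])
  next
    fix X Y f g k \<alpha> \<beta>
    assume "\<alpha> \<in> Surf (Syn G x) X Y f g" "\<beta> \<in> Surf (Syn G x) X Y g k"
    then obtain \<sigma> \<tau> where wt: "wt_rw G x X \<sigma> f g Y" "wt_rw G x X \<tau> g k Y"
      and eq: "\<alpha> = rw_class G x X Y \<sigma>" "\<beta> = rw_class G x X Y \<tau>" by (elim Surf_SynE)
    show "on_surf ?F X Y f k (VComp (Syn G x) X Y \<beta> \<alpha>) =
      VComp B (on_node ?F X) (on_node ?F Y) (on_surf ?F X Y g k \<beta>) (on_surf ?F X Y f g \<alpha>)"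
      by (simp add: eq Syn_VComp[OF wt] extension_on_surf[OF wt_rw.Seq[OF wt]]
          extension_on_surf[OF wt(1)] extension_on_surf[OF wt(2)] rw_facts[OF wt(1)])
  next
    fix X assume "X \<in> Node (Syn G x)"
    then show "iso_cell B (on_node ?F X) (on_node ?F X) (Id1 B (on_node ?F X))
       (on_edge ?F X X (Id1 (Syn G x) X)) (unit_cell ?F X)"
      unfolding iso_cell_def
      by (auto intro!: bexI Id2_cell Id1_edge VComp_Id2_left simp: N_Node)
  next
    fix X Y Z f g assume "f \<in> Edge (Syn G x) X Y" "g \<in> Edge (Syn G x) Y Z"
    then have "wt_trm G x X f Y" "wt_trm G x Y g Z" by simp_all
    note f = this[THEN trm_typing]
    have "Comp1 B (N X) (N Y) (N Z) (E Y g) (E X f) \<in> Edge B (N X) (N Z)"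
      using f by (simp add: Comp1_edge)
    then show "iso_cell B (on_node ?F X) (on_node ?F Z)
       (Comp1 B (on_node ?F X) (on_node ?F Y) (on_node ?F Z) (on_edge ?F Y Z g) (on_edge ?F X Y f))
       (on_edge ?F X Z (Comp1 (Syn G x) X Y Z g f)) (comp_cell ?F X Y Z g f)"
      unfolding iso_cell_def using f
      by (auto intro!: bexI Id2_cell VComp_Id2_left)
  next
    fix X Y Z f f' g g' \<alpha> \<beta>
    assume "\<alpha> \<in> Surf (Syn G x) X Y f f'" "\<beta> \<in> Surf (Syn G x) Y Z g g'"
    then obtain \<sigma> \<tau> where wt: "wt_rw G x X \<sigma> f f' Y" "wt_rw G x Y \<tau> g g' Z"
      and eq: "\<alpha> = rw_class G x X Y \<sigma>" "\<beta> = rw_class G x Y Z \<tau>" by (elim Surf_SynE)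
    have f: "N X \<in> Node B" "N Z \<in> Node B"
      "Comp1 B (N X) (N Y) (N Z) (E Y g) (E X f) \<in> Edge B (N X) (N Z)"
      "Comp1 B (N X) (N Y) (N Z) (E Y g') (E X f') \<in> Edge B (N X) (N Z)"
      using rw_facts[OF wt(1)] rw_facts[OF wt(2)] by (simp_all add: Comp1_edge)
    have H: "HComp B (N X) (N Y) (N Z) (S Y \<tau>) (S X \<sigma>) \<in> Surf B (N X) (N Z)
      (Comp1 B (N X) (N Y) (N Z) (E Y g) (E X f)) (Comp1 B (N X) (N Y) (N Z) (E Y g') (E X f'))"
      using rw_facts[OF wt(1)] rw_facts[OF wt(2)] by (intro HComp_cell)
    show "VComp B (on_node ?F X) (on_node ?F Z)
       (on_surf ?F X Z (Comp1 (Syn G x) X Y Z g f) (Comp1 (Syn G x) X Y Z g' f')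
         (HComp (Syn G x) X Y Z \<beta> \<alpha>))
       (comp_cell ?F X Y Z g f) =
     VComp B (on_node ?F X) (on_node ?F Z) (comp_cell ?F X Y Z g' f')
       (HComp B (on_node ?F X) (on_node ?F Y) (on_node ?F Z)
         (on_surf ?F Y Z g g' \<beta>) (on_surf ?F X Y f f' \<alpha>))"
      unfolding eq
      by (simp add: Syn_HComp[OF wt] extension_on_surf[OF wt_rw.RSub[OF wt(2,1)]]
          extension_on_surf[OF wt(1)] extension_on_surf[OF wt(2)] rw_facts(7)[OF wt(1)]
          rw_facts(7)[OF wt(2)] VComp_Id2_left[OF f H] VComp_Id2_right[OF f H])
  next
    fix X Y f assume "f \<in> Edge (Syn G x) X Y"
    then have wt: "wt_trm G x X f Y" by simp
    note f = trm_typing[OF wt]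
    have c: "Comp1 B (N X) (N Y) (N Y) (Id1 B (N Y)) (E X f) \<in> Edge B (N X) (N Y)"
      using f by (simp add: Comp1_edge Id1_edge)
    have l: "LUnit B (N X) (N Y) (E X f) \<in>
      Surf B (N X) (N Y) (Comp1 B (N X) (N Y) (N Y) (Id1 B (N Y)) (E X f)) (E X f)"
      using f by (simp add: iso_cell_Surf LUnit_iso)
    show "VComp B (on_node ?F X) (on_node ?F Y)
       (on_surf ?F X Y (Comp1 (Syn G x) X Y Y (Id1 (Syn G x) Y) f) f (LUnit (Syn G x) X Y f))
       (VComp B (on_node ?F X) (on_node ?F Y) (comp_cell ?F X Y Y (Id1 (Syn G x) Y) f)
         (HComp B (on_node ?F X) (on_node ?F Y) (on_node ?F Y)
           (unit_cell ?F Y) (Id2 B (on_node ?F X) (on_node ?F Y) (on_edge ?F X Y f)))) =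
     LUnit B (on_node ?F X) (on_node ?F Y) (on_edge ?F X Y f)"
      using f c by (simp add: extension_on_surf[OF wt_rw.Rho[OF wt]] HComp_Id2 Id1_edge
          VComp_Id2_left[OF _ _ c c] Id2_cell VComp_Id2_right[OF _ _ _ _ l])
  next
    fix X Y f assume "f \<in> Edge (Syn G x) X Y"
    then have wt: "wt_trm G x X f Y" by simp
    note f = trm_typing[OF wt]
    have c: "Comp1 B (N X) (N X) (N Y) (E X f) (Id1 B (N X)) \<in> Edge B (N X) (N Y)"
      using f by (simp add: Comp1_edge Id1_edge)
    have r: "RUnit B (N X) (N Y) (E X f) \<in>
      Surf B (N X) (N Y) (Comp1 B (N X) (N X) (N Y) (E X f) (Id1 B (N X))) (E X f)"
      using f by (simp add: iso_cell_Surf RUnit_iso)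
    show "VComp B (on_node ?F X) (on_node ?F Y)
       (on_surf ?F X Y (Comp1 (Syn G x) X X Y f (Id1 (Syn G x) X)) f (RUnit (Syn G x) X Y f))
       (VComp B (on_node ?F X) (on_node ?F Y) (comp_cell ?F X X Y f (Id1 (Syn G x) X))
         (HComp B (on_node ?F X) (on_node ?F X) (on_node ?F Y)
           (Id2 B (on_node ?F X) (on_node ?F Y) (on_edge ?F X Y f)) (unit_cell ?F X))) =
     RUnit B (on_node ?F X) (on_node ?F Y) (on_edge ?F X Y f)"
      using f c by (simp add: extension_on_surf[OF wt_rw.IotaInv[OF wt]] HComp_Id2 Id1_edge
          VComp_Id2_left[OF _ _ c c] Id2_cell VComp_Id2_right[OF _ _ _ _ r])
  next
    fix W X Y Z f g k
    assume "f \<in> Edge (Syn G x) W X" "g \<in> Edge (Syn G x) X Y" "k \<in> Edge (Syn G x) Y Z"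
    then have wt: "wt_trm G x Y k Z" "wt_trm G x X g Y" "wt_trm G x W f X" by simp_all
    note f = wt[THEN trm_typing]
    let ?s = "Comp1 B (N W) (N X) (N Z) (Comp1 B (N X) (N Y) (N Z) (E Y k) (E X g)) (E W f)"
    let ?t = "Comp1 B (N W) (N Y) (N Z) (E Y k) (Comp1 B (N W) (N X) (N Y) (E X g) (E W f))"
    have c: "?s \<in> Edge B (N W) (N Z)" "?t \<in> Edge B (N W) (N Z)"
      "Comp1 B (N X) (N Y) (N Z) (E Y k) (E X g) \<in> Edge B (N X) (N Z)"
      "Comp1 B (N W) (N X) (N Y) (E X g) (E W f) \<in> Edge B (N W) (N Y)"
      using f by (simp_all add: Comp1_edge)
    have a: "Asc B (N W) (N X) (N Y) (N Z) (E Y k) (E X g) (E W f) \<in> Surf B (N W) (N Z) ?s ?t"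
      using f by (simp add: iso_cell_Surf Asc_iso)
    show "VComp B (on_node ?F W) (on_node ?F Z)
       (on_surf ?F W Z
         (Comp1 (Syn G x) W X Z (Comp1 (Syn G x) X Y Z k g) f)
         (Comp1 (Syn G x) W Y Z k (Comp1 (Syn G x) W X Y g f))
         (Asc (Syn G x) W X Y Z k g f))
       (VComp B (on_node ?F W) (on_node ?F Z)
         (comp_cell ?F W X Z (Comp1 (Syn G x) X Y Z k g) f)
         (HComp B (on_node ?F W) (on_node ?F X) (on_node ?F Z)
           (comp_cell ?F X Y Z k g) (Id2 B (on_node ?F W) (on_node ?F X) (on_edge ?F W X f)))) =
     VComp B (on_node ?F W) (on_node ?F Z)
       (comp_cell ?F W Y Z k (Comp1 (Syn G x) W X Y g f))
       (VComp B (on_node ?F W) (on_node ?F Z)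
         (HComp B (on_node ?F W) (on_node ?F Y) (on_node ?F Z)
           (Id2 B (on_node ?F Y) (on_node ?F Z) (on_edge ?F Y Z k)) (comp_cell ?F W X Y g f))
         (Asc B (on_node ?F W) (on_node ?F X) (on_node ?F Y) (on_node ?F Z)
           (on_edge ?F Y Z k) (on_edge ?F X Y g) (on_edge ?F W X f)))"
      using f c by (simp add: extension_on_surf[OF wt_rw.Assoc[OF wt]] HComp_Id2
          VComp_Id2_left[OF _ _ c(1) c(1)] Id2_cell VComp_Id2_right[OF _ _ _ _ a]
          VComp_Id2_left[OF _ _ _ _ a])
  next
    fix X assume "X \<in> Node (Syn G x)"
    then show "on_edge ?F X X (Id1 (Syn G x) X) = Id1 B (on_node ?F X)" by simp
  next
    fix X Y Z f g assume "f \<in> Edge (Syn G x) X Y" "g \<in> Edge (Syn G x) Y Z"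
    then show "on_edge ?F X Z (Comp1 (Syn G x) X Y Z g f) =
      Comp1 B (on_node ?F X) (on_node ?F Y) (on_node ?F Z) (on_edge ?F Y Z g) (on_edge ?F X Y f)"
      using trm_typing[of x X f Y] trm_typing[of x Y g Z] by simp
  qed simp_all
qed

lemma extension_incl: "hom_eq G (hom_comp extension (incl G x)) h"
  unfolding hom_eq_def
  by (auto simp: hom_comp_def incl_def extension_on_surf[OF wt_rw.Surface])

section \<open>Uniqueness of the strict extension\<close>

context
  fixes F x
  assumes F: "strict_pseudofunctor (Syn G x) B F" and F_incl: "hom_eq G (hom_comp F (incl G x)) h"
begin

interpretation F: strict_pseudofunctor "Syn G x" B F by (rule F)

lemma on_node_eq: "A \<in> Node G \<Longrightarrow> on_node F A = N A"
  using F_incl by (simp add: hom_eq_def hom_comp_def incl_def)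

text \<open>\<open>F\<close> is defined on terms over the fixed \<open>x\<close>, but the induction
  meets bodies over arbitrary bound variables. Collapsing brings these into the domain of
  \<open>F\<close>, where strictness determines the value on a substitution.\<close>

lemma on_edge_collapse: "wt_trm G y A t C \<Longrightarrow> on_edge F A C (collapse_trm x t) = E A t"
proof (induction rule: wt_trm.induct)
  case (Var A y)
  then show ?case using F.strict_Id1[of A] by (simp add: on_node_eq)
next
  case (Cst A C c y)
  then show ?case using F_incl by (simp add: hom_eq_def hom_comp_def incl_def)
next
  case (Sub y A t C z D u)
  have "on_edge F D C (Comp1 (Syn G x) D A C (collapse_trm x t) (collapse_trm x u)) =
    Comp1 B (on_node F D) (on_node F A) (on_node F C)
      (on_edge F A C (collapse_trm x t)) (on_edge F D A (collapse_trm x u))"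
    using Sub.hyps wt_trm_nodes[OF Sub.hyps(1)] wt_trm_nodes[OF Sub.hyps(2)]
    by (intro F.strict_Comp1) (simp_all add: wt_trm_collapse)
  then show ?case
    using Sub.IH Sub.hyps[THEN trm_typing] wt_trm_nodes[OF Sub.hyps(1)] wt_trm_nodes[OF Sub.hyps(2)]
    by (simp add: on_node_eq)
qed

lemma on_edge_eq: "wt_trm G x A t C \<Longrightarrow> on_edge F A C t = E A t"
  using on_edge_collapse[of x A t C] by (simp add: collapse_wt_trm)

lemma on_surf_Ident:
  "wt_trm G x A t C \<Longrightarrow>
   on_surf F A C t t (rw_class G x A C (Ident t)) = Id2 B (N A) (N C) (E A t)"
  using F.map_Id2[of A C t] wt_trm_nodes[of G x A t C] by (simp add: on_node_eq on_edge_eq)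

lemma on_surf_Seq:
  assumes "wt_rw G x A \<tau> t t' C" "wt_rw G x A \<tau>' t' t'' C"
  shows "on_surf F A C t t'' (rw_class G x A C (\<tau>' \<bullet> \<tau>)) =
    VComp B (N A) (N C) (on_surf F A C t' t'' (rw_class G x A C \<tau>'))
      (on_surf F A C t t' (rw_class G x A C \<tau>))"
  using assms[THEN wt_rw_trm] assms[THEN Surf_SynI] wt_trm_nodes[of G x A t C]
    F.map_VComp[of A C t t' t'' "rw_class G x A C \<tau>" "rw_class G x A C \<tau>'"]
  by (simp add: on_node_eq Syn_VComp[OF assms] del: Syn_simps(3))

text \<open>Places the values of \<open>F\<close> between the interpreted terms, so that identity
  2-cells of \<open>B\<close> can be cancelled against them.\<close>

lemma on_surf_Surf:
  assumes "wt_rw G x A \<tau> t t' C"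
  shows "on_surf F A C t t' (rw_class G x A C \<tau>) \<in> Surf B (N A) (N C) (E A t) (E A t')"
  using wt_rw_trm[OF assms] Surf_SynI[OF assms] F.hom wt_trm_nodes[of G x A t C]
  unfolding two_graph_hom_def
  by (auto simp: on_node_eq on_edge_eq simp del: Syn_simps(3))

text \<open>Preservation of horizontal composition is not an axiom of pseudofunctors; it comes from
  naturality of \<open>comp_cell\<close>. By strictness the two structural cells in that square are
  identities, and the square collapses to the claim.\<close>

lemma on_surf_RSub:
  assumes \<tau>: "wt_rw G x A \<tau> t t' C" and \<sigma>: "wt_rw G x D \<sigma> u u' A"
  shows "on_surf F D C (t\<lbrace>x \<mapsto> u\<rbrace>) (t'\<lbrace>x \<mapsto> u'\<rbrace>) (rw_class G x D C (\<tau>\<llangle>x \<mapsto> \<sigma>\<rrangle>)) =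
    HComp B (N D) (N A) (N C) (on_surf F A C t t' (rw_class G x A C \<tau>))
      (on_surf F D A u u' (rw_class G x D A \<sigma>))"
proof -
  note wt = wt_rw_trm[OF \<tau>, THEN conjunct1] wt_rw_trm[OF \<tau>, THEN conjunct2]
    wt_rw_trm[OF \<sigma>, THEN conjunct1] wt_rw_trm[OF \<sigma>, THEN conjunct2]
  note nodes = wt_trm_nodes[OF wt(1)] wt_trm_nodes[OF wt(3)]
  note f = rw_facts[OF \<tau>] rw_facts[OF \<sigma>]
  let ?F\<tau> = "on_surf F A C t t' (rw_class G x A C \<tau>)"
  let ?F\<sigma> = "on_surf F D A u u' (rw_class G x D A \<sigma>)"
  let ?F\<tau>\<sigma> = "on_surf F D C (t\<lbrace>x \<mapsto> u\<rbrace>) (t'\<lbrace>x \<mapsto> u'\<rbrace>) (rw_class G x D C (\<tau>\<llangle>x \<mapsto> \<sigma>\<rrangle>))"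
  let ?c = "Comp1 B (N D) (N A) (N C) (E A t) (E D u)"
  let ?c' = "Comp1 B (N D) (N A) (N C) (E A t') (E D u')"
  have c: "?c \<in> Edge B (N D) (N C)" "?c' \<in> Edge B (N D) (N C)"
    using f by (simp_all add: Comp1_edge)
  have F\<tau>\<sigma>: "?F\<tau>\<sigma> \<in> Surf B (N D) (N C) ?c ?c'"
    using on_surf_Surf[OF wt_rw.RSub[OF \<tau> \<sigma>]] f by simp
  have H: "HComp B (N D) (N A) (N C) ?F\<tau> ?F\<sigma> \<in> Surf B (N D) (N C) ?c ?c'"
    using f on_surf_Surf[OF \<tau>] on_surf_Surf[OF \<sigma>] by (intro HComp_cell)
  have "VComp B (N D) (N C) ?F\<tau>\<sigma> (Id2 B (N D) (N C) ?c) =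
    VComp B (N D) (N C) (Id2 B (N D) (N C) ?c') (HComp B (N D) (N A) (N C) ?F\<tau> ?F\<sigma>)"
    using F.comp_cell_natural[of D A C u u' t t' "rw_class G x D A \<sigma>" "rw_class G x A C \<tau>"]
      Surf_SynI[OF \<tau>] Surf_SynI[OF \<sigma>] wt nodes
    by (simp add: Syn_HComp[OF \<sigma> \<tau>] F.strict_comp_cell on_node_eq on_edge_eq del: Syn_simps(3))
  then show ?thesis
    using f by (simp add: VComp_Id2_left[OF _ _ c H] VComp_Id2_right[OF _ _ c F\<tau>\<sigma>])
qed

text \<open>With identity structural cells, left unit coherence says that \<open>F\<close> sends the
  left unitor to the left unitor. The other two coherence laws are exploited in the same way for
  \<open>IotaInv\<close> and \<open>Assoc\<close>.\<close>

lemma on_surf_Rho: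
  assumes wt: "wt_trm G x A u C"
  shows "on_surf F A C (Var x\<lbrace>x \<mapsto> u\<rbrace>) u (rw_class G x A C (Rho u)) = LUnit B (N A) (N C) (E A u)"
proof -
  note nodes = wt_trm_nodes[OF wt] and f = trm_typing[OF wt]
  have var: "wt_trm G x C (Var x) C" using nodes by (simp add: wt_trm.Var)
  let ?c = "Comp1 B (N A) (N C) (N C) (Id1 B (N C)) (E A u)"
  have c: "?c \<in> Edge B (N A) (N C)" using f by (simp add: Comp1_edge Id1_edge)
  have l: "on_surf F A C (Var x\<lbrace>x \<mapsto> u\<rbrace>) u (rw_class G x A C (Rho u)) \<in>
    Surf B (N A) (N C) ?c (E A u)"
    using on_surf_Surf[OF wt_rw.Rho[OF wt]] f by simp
  show ?thesis
    using F.left_unit_coherence[of A C u] nodes f wt var c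
    by (simp add: F.strict_comp_cell F.strict_unit_cell on_node_eq on_edge_eq HComp_Id2 Id1_edge
        VComp_Id2_left[OF _ _ c c] Id2_cell VComp_Id2_right[OF _ _ _ _ l])
qed

lemma on_surf_IotaInv:
  assumes wt: "wt_trm G x A t C"
  shows "on_surf F A C (t\<lbrace>x \<mapsto> Var x\<rbrace>) t (rw_class G x A C (IotaInv t)) =
    RUnit B (N A) (N C) (E A t)"
proof -
  note nodes = wt_trm_nodes[OF wt] and f = trm_typing[OF wt]
  have var: "wt_trm G x A (Var x) A" using nodes by (simp add: wt_trm.Var)
  let ?c = "Comp1 B (N A) (N A) (N C) (E A t) (Id1 B (N A))"
  have c: "?c \<in> Edge B (N A) (N C)" using f by (simp add: Comp1_edge Id1_edge)
  have r: "on_surf F A C (t\<lbrace>x \<mapsto> Var x\<rbrace>) t (rw_class G x A C (IotaInv t)) \<in>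
    Surf B (N A) (N C) ?c (E A t)"
    using on_surf_Surf[OF wt_rw.IotaInv[OF wt]] f by simp
  show ?thesis
    using F.right_unit_coherence[of A C t] nodes f wt var c
    by (simp add: F.strict_comp_cell F.strict_unit_cell on_node_eq on_edge_eq HComp_Id2 Id1_edge
        VComp_Id2_left[OF _ _ c c] Id2_cell VComp_Id2_right[OF _ _ _ _ r])
qed

lemma on_surf_Assoc:
  assumes wt: "wt_trm G x Y k Z" "wt_trm G x X g Y" "wt_trm G x W f X"
  shows "on_surf F W Z (k\<lbrace>x \<mapsto> g\<rbrace>\<lbrace>x \<mapsto> f\<rbrace>) (k\<lbrace>x \<mapsto> g\<lbrace>x \<mapsto> f\<rbrace>\<rbrace>) (rw_class G x W Z (Assoc k x g x f)) =
    Asc B (N W) (N X) (N Y) (N Z) (E Y k) (E X g) (E W f)"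
proof -
  note nodes = wt[THEN wt_trm_nodes] and f = wt[THEN trm_typing]
  note sub = wt_trm.Sub[OF wt(1,2)] wt_trm.Sub[OF wt(2,3)]
  let ?s = "Comp1 B (N W) (N X) (N Z) (Comp1 B (N X) (N Y) (N Z) (E Y k) (E X g)) (E W f)"
  let ?t = "Comp1 B (N W) (N Y) (N Z) (E Y k) (Comp1 B (N W) (N X) (N Y) (E X g) (E W f))"
  have c: "?s \<in> Edge B (N W) (N Z)" "?t \<in> Edge B (N W) (N Z)"
    "Comp1 B (N X) (N Y) (N Z) (E Y k) (E X g) \<in> Edge B (N X) (N Z)"
    "Comp1 B (N W) (N X) (N Y) (E X g) (E W f) \<in> Edge B (N W) (N Y)"
    using f by (simp_all add: Comp1_edge)
  have a: "Asc B (N W) (N X) (N Y) (N Z) (E Y k) (E X g) (E W f) \<in> Surf B (N W) (N Z) ?s ?t"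
    using f by (simp add: iso_cell_Surf Asc_iso)
  have Fa: "on_surf F W Z (k\<lbrace>x \<mapsto> g\<rbrace>\<lbrace>x \<mapsto> f\<rbrace>) (k\<lbrace>x \<mapsto> g\<lbrace>x \<mapsto> f\<rbrace>\<rbrace>) (rw_class G x W Z (Assoc k x g x f)) \<in>
    Surf B (N W) (N Z) ?s ?t"
    using on_surf_Surf[OF wt_rw.Assoc[OF wt]] f by simp
  show ?thesis
    using F.assoc_coherence[of W X Y Z f g k] nodes f wt sub c
    by (simp add: F.strict_comp_cell on_node_eq on_edge_eq HComp_Id2
        VComp_Id2_left[OF _ _ c(1) c(1)] Id2_cell VComp_Id2_right[OF _ _ _ _ Fa]
        VComp_Id2_right[OF _ _ _ _ a] VComp_Id2_left[OF _ _ _ _ a])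
qed

text \<open>\<open>F\<close> sends \<open>\<tau>'\<close> to a left inverse of
  \<open>\<alpha>\<close>, while the chosen \<open>inv_cell\<close> is a right inverse; hence they
  coincide. Thus the arbitrary choice made in the interpretation agrees with every strict
  extension.\<close>

lemma on_surf_inverse:
  assumes wt: "wt_rw G x A \<tau> t t' C" "wt_rw G x A \<tau>' t' t C"
    and eq: "eq_rw G x A (\<tau>' \<bullet> \<tau>) (Ident t) t t C"
    and \<tau>: "on_surf F A C t t' (rw_class G x A C \<tau>) = \<alpha>"
    and iso: "iso_cell B (N A) (N C) (E A t) (E A t') \<alpha>"
  shows "on_surf F A C t' t (rw_class G x A C \<tau>') = inv_cell B (N A) (N C) (E A t) (E A t') \<alpha>"
proof (rule hom_category.inverse_unique[OF hom_category_cells, of "N A" "N C" "E A t" "E A t'" \<alpha>])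
  show "VComp B (N A) (N C) (on_surf F A C t' t (rw_class G x A C \<tau>')) \<alpha> =
    Id2 B (N A) (N C) (E A t)"
    using on_surf_Seq[OF wt] on_surf_Ident wt_rw_trm[OF wt(1)] rw_class_eq[OF eq]
    by (simp add: \<tau>)
qed (use on_surf_Surf[OF wt(2)] rw_facts[OF wt(1)] iso in
    \<open>simp_all add: iso_cell_Surf inv_cell(1,3)\<close>)

text \<open>As for terms, the derivation may be over any context variable. Surfaces are fixed by
  agreement with \<open>h\<close>, composites by the preservation laws, structural cells by
  coherence and the remaining formal inverses by uniqueness of inverses.\<close>

lemma on_surf_collapse:
  "wt_rw G y A \<tau> t t' C \<Longrightarrow>
   on_surf F A C (collapse_trm x t) (collapse_trm x t') (rw_class G x A C (collapse_rw x \<tau>)) = S A \<tau>"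
proof (induction rule: wt_rw.induct)
  case (Ident y A t C)
  then show ?case
    using on_surf_Ident[OF wt_trm_collapse[OF Ident]] trm_typing[OF Ident] by simp
next
  case (Surface A C c c' \<sigma> y)
  then show ?case using F_incl by (simp add: hom_eq_def hom_comp_def incl_def)
next
  case (Iota y A t C)
  \<comment> \<open>Here \<open>IotaInv\<close> is the structural cell with known value and
    \<open>Iota\<close> is its inverse, the reverse of the situation for \<open>Rho\<close> and
    \<open>Assoc\<close>.\<close>
  note wt = wt_trm_collapse[OF Iota, of x] and f = trm_typing[OF Iota]
  show ?case
    using on_surf_inverse[OF wt_rw.IotaInv[OF wt] wt_rw.Iota[OF wt] eq_rw.Iota_IotaInv[OF wt]
      on_surf_IotaInv[OF wt]] f trm_typing[OF wt] by (simp add: RUnit_iso)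
next
  case (Rho y D u A z)
  then show ?case using on_surf_Rho[OF wt_trm_collapse[OF Rho]] trm_typing[OF Rho] by simp
next
  case (Assoc y C t T z A v w D u)
  then show ?case
    using on_surf_Assoc[OF Assoc[THEN wt_trm_collapse]] Assoc[THEN trm_typing] by simp
next
  case (IotaInv y A t C)
  then show ?case
    using on_surf_IotaInv[OF wt_trm_collapse[OF IotaInv]] trm_typing[OF IotaInv] by simp
next
  case (RhoInv y D u A z)
  note wt = wt_trm_collapse[OF RhoInv, of x] and f = trm_typing[OF RhoInv]
  show ?case
    using on_surf_inverse[OF wt_rw.Rho[OF wt] wt_rw.RhoInv[OF wt] eq_rw.RhoInv_Rho[OF wt]
      on_surf_Rho[OF wt]] f trm_typing[OF wt] by (simp add: LUnit_iso)
next
  case (AssocInv y C t T z A v w D u)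
  note wt = AssocInv[THEN wt_trm_collapse, of x] and f = AssocInv[THEN trm_typing]
  show ?case
    using on_surf_inverse[OF wt_rw.Assoc[OF wt] wt_rw.AssocInv[OF wt] eq_rw.AssocInv_Assoc[OF wt]
      on_surf_Assoc[OF wt]] f wt[THEN trm_typing] by (simp add: Asc_iso)
next
  case (Seq y A \<tau> t t' C \<tau>' t'')
  then show ?case
    using on_surf_Seq[OF Seq.hyps[THEN wt_rw_collapse]] rw_facts(7)[OF Seq.hyps(1)] by simp
next
  case (RSub y A \<tau> t t' C z D \<sigma> u u')
  then show ?case
    using on_surf_RSub[OF RSub.hyps[THEN wt_rw_collapse]] RSub.hyps[THEN rw_facts(7)] by simp
qed

text \<open>Every 2-cell of \<open>Syn\<close> has a representative derivable over \<open>x\<close>,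
  which collapsing leaves unchanged; the comparison after collapse is therefore a comparison of the
  actual values.\<close>

lemma extension_unique: "psfun_eq (Syn G x) F extension"
  unfolding psfun_eq_def
proof (intro conjI ballI)
  have "on_surf F A C t t' \<alpha> = on_surf extension A C t t' \<alpha>"
    if mem: "\<alpha> \<in> Surf (Syn G x) A C t t'" for A C t t' \<alpha>
  proof -
    obtain \<tau> where wt: "wt_rw G x A \<tau> t t' C" and \<alpha>: "\<alpha> = rw_class G x A C \<tau>"
      using mem by (rule Surf_SynE)
    have "collapse_trm x t = t" "collapse_trm x t' = t'"
      using wt_rw_trm[OF wt] by (simp_all add: collapse_wt_trm[of G x A _ C])
    then show ?thesis
      using on_surf_collapse[OF wt]
      by (simp add: \<alpha> extension_on_surf[OF wt] collapse_wt_rw[OF wt])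
  qed
  then show "hom_eq (Syn G x) F extension"
    unfolding hom_eq_def by (simp add: on_node_eq on_edge_eq del: Syn_simps(3))
qed (simp_all add: F.strict_unit_cell F.strict_comp_cell on_node_eq on_edge_eq)

end

end


theorem theoremV5:
  fixes G :: "('n, 'e, 's) two_graph" and x :: var
    and B :: "('o, 'a, 'c) bicat" and h :: "('n, 'e, 's, 'o, 'a, 'c) hom"
  assumes "bicategory B" and "two_graph_hom G B h"
  shows "\<exists>F. strict_pseudofunctor (Syn G x) B F \<and> hom_eq G (hom_comp F (incl G x)) h \<and>
    (\<forall>F'. strict_pseudofunctor (Syn G x) B F' \<and> hom_eq G (hom_comp F' (incl G x)) h \<longrightarrow>
      psfun_eq (Syn G x) F' F)"
proof -
  interpret two_graph_model B G h
    using assms by (intro two_graph_model.intro two_graph_model_axioms.intro)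
  show ?thesis
    using strict_pseudofunctor_extension extension_incl extension_unique by blast
qed

end
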